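(* Let $K$ be a field, $S=K[x_1,\ldots,x_n]$, and let $I\subsetneq J\subset S$ be two monomial ideals. Let $G(I)=\{v_1,\ldots,v_p\}$ and $G(J)=\{u_1,\ldots,u_q\}$ be their sets of minimal monomial generators (with $|G(I)|=p$, $|G(J)|=q$), indexed so that, for some integer $r\geq 0$, $u_1=v_1,\ldots,u_r=v_r$ and $u_{r+1},\ldots,u_q\notin I$. Then $$\operatorname{sdepth}(J/I)\geq n-p-\left\lfloor\frac{q-r}{2}\right\rfloor.$$
   Context: Such an indexing always exists: any minimal monomial generator of $J$ that lies in $I$ is also a minimal monomial generator of $I$; thus $r$ is the number of elements of $G(J)$ lying in $I$. Let $M$ be a nonzero $\mathbb Z^n$-graded $S$-module. A Stanley decomposition of $M$ is a direct sum $\mathcal D: M=\bigoplus_{i=1}^s m_iK[Z_i]$ as $\mathbb Z^n$-graded $K$-vector spaces, where each $m_i\in M$ is homogeneous with respect to the $\mathbb Z^n$-grading, $Z_i\subset\{x_1,\ldots,x_n\}$, and $m_iK[Z_i]=\{um_i:\ u\in K[Z_i]\}\subset M$ is a free $K[Z_i]$-submodule of $M$. Put $\operatorname{sdepth}(\mathcal D)=\min_{i}|Z_i|$. The Stanley depth $\operatorname{sdepth}(M)$ is the maximum of $\operatorname{sdepth}(\mathcal D)$ over all Stanley decompositions $\mathcal D$ of $M$. *)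

theory Defs
  imports Complex_Main "HOL-Library.Poly_Mapping" "HOL-Algebra.Module" "HOL-Algebra.QuotRing"
begin

section \<open>Polynomial rings and monomial ideals\<close>

type_synonym 'k mpoly = "(nat \<Rightarrow>\<^sub>0 nat) \<Rightarrow>\<^sub>0 'k"

text \<open>
  \<open>poly_ring Z\<close> is the polynomial ring $K[Z]$ in the variables $x_i$, $i \in Z$, over the field
  $K$ given by the type \<open>'k\<close>. So $S = K[x_1,\ldots,x_n]$ is \<open>poly_ring {1..n}\<close>, and
  the rings $K[Z]$ with $Z \subseteq \{x_1,\ldots,x_n\}$ are subrings of it.
\<close>

definition poly_ring :: "nat set \<Rightarrow> 'k::field mpoly ring" where
  "poly_ring Z =
    \<lparr>carrier = {f. \<forall>t\<in>Poly_Mapping.keys f. Poly_Mapping.keys t \<subseteq> Z},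
     monoid.mult = (*), one = 1, zero = 0, add = (+)\<rparr>"

definition monomials :: "nat set \<Rightarrow> 'k::field mpoly set" where
  "monomials Z = {Poly_Mapping.single t 1 | t. Poly_Mapping.keys t \<subseteq> Z}"

definition monomial_ideal :: "nat \<Rightarrow> 'k::field mpoly set \<Rightarrow> bool" where
  "monomial_ideal n I \<longleftrightarrow> (\<exists>G\<subseteq>monomials {1..n}. I = Idl\<^bsub>poly_ring {1..n}\<^esub> G)"

text \<open>
  A monomial ideal has exactly one minimal generating set consisting of monomials;
  \<open>minimal_monomial_generators n I G\<close> says that \<open>G\<close> is this set $G(I)$.
\<close>

definition minimal_monomial_generators ::
    "nat \<Rightarrow> 'k::field mpoly set \<Rightarrow> 'k mpoly set \<Rightarrow> bool" where
  "minimal_monomial_generators n I G \<longleftrightarrow>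
     G \<subseteq> monomials {1..n} \<and> Idl\<^bsub>poly_ring {1..n}\<^esub> G = I \<and>
     (\<forall>H. H \<subset> G \<longrightarrow> Idl\<^bsub>poly_ring {1..n}\<^esub> H \<noteq> I)"


section \<open>Graded modules\<close>

definition internal_direct_sum ::
    "('b, 'm) ring_scheme \<Rightarrow> 'i set \<Rightarrow> ('i \<Rightarrow> 'b set) \<Rightarrow> bool" where
  "internal_direct_sum M A V \<longleftrightarrow>
     (\<forall>i\<in>A. additive_subgroup (V i) M) \<and>
     (\<forall>x\<in>carrier M. \<exists>!y. y \<in> (\<Pi>\<^sub>E i\<in>A. V i) \<and> finite {i\<in>A. y i \<noteq> \<zero>\<^bsub>M\<^esub>} \<and>
        x = finsum M y {i\<in>A. y i \<noteq> \<zero>\<^bsub>M\<^esub>})"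

text \<open>The group $\mathbb{Z}^n$, with coordinates indexed by \<open>{1..n}\<close>.\<close>

definition Zn :: "nat \<Rightarrow> (nat \<Rightarrow> int) set" where
  "Zn n = {a. \<forall>i. i \<notin> {1..n} \<longrightarrow> a i = 0}"

definition homogeneous_part :: "nat \<Rightarrow> (nat \<Rightarrow> int) \<Rightarrow> 'k::field mpoly set" where
  "homogeneous_part n a =
     {f \<in> carrier (poly_ring {1..n}).
        \<forall>t\<in>Poly_Mapping.keys f. \<forall>i. int (Poly_Mapping.lookup t i) = a i}"

text \<open>The components of a grading are $K$-subspaces because $K$ sits in degree $0$ of $S$.\<close>

locale Zn_graded_module = Module.module "poly_ring {1..n}" M
  for n :: nat and M :: "('k::field mpoly, 'b, 'm) module_scheme" (structure) +
  fixes gr :: "(nat \<Rightarrow> int) \<Rightarrow> 'b set"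
  assumes direct_sum: "internal_direct_sum M (Zn n) gr"
    and smult_graded: "\<lbrakk>a \<in> Zn n; b \<in> Zn n; f \<in> homogeneous_part n a; x \<in> gr b\<rbrakk>
      \<Longrightarrow> f \<odot> x \<in> gr (\<lambda>i. a i + b i)"


section \<open>Stanley decompositions and Stanley depth\<close>

definition cyclic_span :: "('k::field mpoly, 'b, 'm) module_scheme \<Rightarrow> 'b \<Rightarrow> nat set \<Rightarrow> 'b set" where
  "cyclic_span M m Z = {u \<odot>\<^bsub>M\<^esub> m | u. u \<in> carrier (poly_ring Z)}"

text \<open>
  A Stanley decomposition $M = \bigoplus_{i=1}^s m_i K[Z_i]$. The second line says that
  $m_i K[Z_i]$ is free over $K[Z_i]$ on $m_i$. As the $m_i$ are homogeneous, the summands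
  are graded subspaces, so the direct sum is one of $\mathbb{Z}^n$-graded spaces.
\<close>

definition stanley_decomposition ::
    "nat \<Rightarrow> ('k::field mpoly, 'b, 'm) module_scheme \<Rightarrow> ((nat \<Rightarrow> int) \<Rightarrow> 'b set) \<Rightarrow>
     nat \<Rightarrow> (nat \<Rightarrow> 'b) \<Rightarrow> (nat \<Rightarrow> nat set) \<Rightarrow> bool" where
  "stanley_decomposition n M gr s m Z \<longleftrightarrow>
     (\<forall>i\<in>{1..s}. m i \<in> carrier M \<and> (\<exists>a\<in>Zn n. m i \<in> gr a) \<and> Z i \<subseteq> {1..n} \<and>
        (\<forall>u\<in>carrier (poly_ring (Z i)). u \<odot>\<^bsub>M\<^esub> m i = \<zero>\<^bsub>M\<^esub> \<longrightarrow> u = 0)) \<and>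
     internal_direct_sum M {1..s} (\<lambda>i. cyclic_span M (m i) (Z i))"

text \<open>
  For a nonzero module every decomposition has \<open>s \<ge> 1\<close>, so the minimum is taken over a nonempty set;
  it is at most \<open>n\<close>, so the maximum is over a finite set.
\<close>

definition sdepth ::
    "nat \<Rightarrow> ('k::field mpoly, 'b, 'm) module_scheme \<Rightarrow> ((nat \<Rightarrow> int) \<Rightarrow> 'b set) \<Rightarrow> nat" where
  "sdepth n M gr =
     Max {Min ((\<lambda>i. card (Z i)) ` {1..s}) | s m Z. stanley_decomposition n M gr s m Z}"


section \<open>The graded module $J/I$\<close>

text \<open>
  The cosets of \<open>I\<close> in \<open>J\<close>, as a module over \<open>R\<close>: a scalar \<open>f\<close> takes \<open>I + g\<close> to \<open>I + f g\<close>.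
  Module records extend ring records; the fields \<open>mult\<close> and \<open>one\<close> play no role.
\<close>

definition quotient_module :: "('a, 'r) ring_scheme \<Rightarrow> 'a set \<Rightarrow> 'a set \<Rightarrow> ('a, 'a set) module" where
  "quotient_module R J I =
    \<lparr>carrier = (\<lambda>g. I +>\<^bsub>R\<^esub> g) ` J, monoid.mult = rcoset_mult R I, one = I +>\<^bsub>R\<^esub> \<one>\<^bsub>R\<^esub>,
     zero = I, add = set_add R, smult = (\<lambda>f. rcoset_mult R I (I +>\<^bsub>R\<^esub> f))\<rparr>"

definition quotient_grading ::
    "nat \<Rightarrow> 'k::field mpoly set \<Rightarrow> 'k mpoly set \<Rightarrow> (nat \<Rightarrow> int) \<Rightarrow> 'k mpoly set set" where
  "quotient_grading n J I a =
     (\<lambda>g. I +>\<^bsub>poly_ring {1..n}\<^esub> g) ` (J \<inter> homogeneous_part n a)"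


text \<open>The rest of the theory checks that $J/I$ is indeed a $\mathbb{Z}^n$-graded $S$-module.\<close>

lemma keys_uminus: "Poly_Mapping.keys (- f :: 'k::field mpoly) = Poly_Mapping.keys f"
  by (auto simp: in_keys_iff)

lemma poly_ring_simps [simp]:
  "monoid.mult (poly_ring Z) = (*)" "monoid.one (poly_ring Z) = 1"
  "ring.zero (poly_ring Z) = 0" "ring.add (poly_ring Z) = (+)"
  by (simp_all add: poly_ring_def)

lemma in_poly_ring_iff:
  "f \<in> carrier (poly_ring Z) \<longleftrightarrow> (\<forall>t\<in>Poly_Mapping.keys f. Poly_Mapping.keys t \<subseteq> Z)"
  by (simp add: poly_ring_def)

lemma poly_ring_closed:
  assumes "f \<in> carrier (poly_ring Z)" "g \<in> carrier (poly_ring Z)"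
  shows "f + g \<in> carrier (poly_ring Z)" "f * g \<in> carrier (poly_ring Z)" "- f \<in> carrier (poly_ring Z)"
proof -
  show "f + g \<in> carrier (poly_ring Z)"
    using assms Poly_Mapping.keys_add[of f g] unfolding in_poly_ring_iff by blast
  show "- f \<in> carrier (poly_ring Z)"
    using assms by (simp add: in_poly_ring_iff keys_uminus)
  show "f * g \<in> carrier (poly_ring Z)"
    unfolding in_poly_ring_iff
  proof
    fix t assume "t \<in> Poly_Mapping.keys (f * g)"
    then obtain a b where "t = a + b" "a \<in> Poly_Mapping.keys f" "b \<in> Poly_Mapping.keys g"
      using keys_mult[of f g] by blast
    with assms show "Poly_Mapping.keys t \<subseteq> Z"
      using Poly_Mapping.keys_add[of a b] unfolding in_poly_ring_iff by blast
  qed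
qed

lemma poly_ring_cring: "cring (poly_ring Z :: 'k::field mpoly ring)"
proof (intro cringI abelian_groupI comm_monoidI)
  fix f :: "'k mpoly" assume "f \<in> carrier (poly_ring Z)"
  then show "\<exists>g\<in>carrier (poly_ring Z). g \<oplus>\<^bsub>poly_ring Z\<^esub> f = \<zero>\<^bsub>poly_ring Z\<^esub>"
    by (intro bexI[of _ "- f"]) (simp_all add: poly_ring_closed)
qed (auto simp: poly_ring_closed algebra_simps, auto simp: in_poly_ring_iff)

lemma poly_ring_a_inv:
  assumes "f \<in> carrier (poly_ring Z)" shows "\<ominus>\<^bsub>poly_ring Z\<^esub> f = - f"
proof -
  interpret cring "poly_ring Z :: 'a mpoly ring" by (rule poly_ring_cring)
  show ?thesis using assms by (intro minus_equality) (simp_all add: poly_ring_closed)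
qed

lemma monomial_ideal_ideal:
  assumes "monomial_ideal n I" shows "ideal I (poly_ring {1..n})"
proof -
  interpret cring "poly_ring {1..n} :: 'a mpoly ring" by (rule poly_ring_cring)
  obtain G where G: "G \<subseteq> monomials {1..n}" "I = Idl\<^bsub>poly_ring {1..n}\<^esub> G"
    using assms unfolding monomial_ideal_def by blast
  have "G \<subseteq> carrier (poly_ring {1..n})" using G(1) by (auto simp: monomials_def in_poly_ring_iff)
  then show ?thesis unfolding G(2) by (rule genideal_ideal)
qed

lemma quotient_module_module:
  assumes "cring R" "ideal I R" "ideal J R" "I \<subseteq> J"
  shows "Module.module R (quotient_module R J I)"
proof -
  interpret R: cring R by fact
  interpret I: ideal I R by fact
  interpret Q: ring "R Quot I" by (rule I.quotient_is_ring)
  interpret QJ: ideal "(+>\<^bsub>R\<^esub>) I ` J" "R Quot I"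
    by (rule R.ring_ideal_imp_quot_ideal) fact+
  have sub: "J \<subseteq> carrier R" using assms(3) by (meson additive_subgroup.a_subset ideal.axioms(1))
  have J_mult: "f \<otimes>\<^bsub>R\<^esub> g \<in> J" if "f \<in> carrier R" "g \<in> J" for f g
    using that assms(3) by (simp add: ideal.I_l_closed)
  have J_add: "f \<oplus>\<^bsub>R\<^esub> g \<in> J" if "f \<in> J" "g \<in> J" for f g
    using that assms(3) by (simp add: additive_subgroup.a_closed ideal.axioms(1))
  have J_inv: "\<ominus>\<^bsub>R\<^esub> g \<in> J" if "g \<in> J" for g
    using that assms(3) by (simp add: additive_subgroup.a_inv_closed ideal.axioms(1))
  have I_zero: "I = I +>\<^bsub>R\<^esub> \<zero>\<^bsub>R\<^esub>" by (simp add: I.a_subset R.a_coset_add_zero)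
  have ag: "abelian_group (quotient_module R J I)"
  proof (rule abelian_groupI)
    show "\<zero>\<^bsub>quotient_module R J I\<^esub> \<in> carrier (quotient_module R J I)"
      
      unfolding quotient_module_def using I_zero assms(4) I.zero_closed by (metis imageI partial_object.select_convs(1) ring.select_convs(1) subsetD)
  next
    fix x assume "x \<in> carrier (quotient_module R J I)"
    then obtain g where g: "g \<in> J" "x = I +>\<^bsub>R\<^esub> g" by (auto simp: quotient_module_def)
    then show "\<zero>\<^bsub>quotient_module R J I\<^esub> \<oplus>\<^bsub>quotient_module R J I\<^esub> x = x"
      using sub I.a_rcos_sum[of "\<zero>\<^bsub>R\<^esub>" g] I_zero by (auto simp: quotient_module_def)
    show "\<exists>y\<in>carrier (quotient_module R J I).
        y \<oplus>\<^bsub>quotient_module R J I\<^esub> x = \<zero>\<^bsub>quotient_module R J I\<^esub>"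
      using g sub I_zero J_inv[OF g(1)]
      by (auto simp: quotient_module_def I.a_rcos_sum R.l_neg subset_iff intro!: bexI[of _ "\<ominus>\<^bsub>R\<^esub> g"])
  next
    fix x y z assume "x \<in> carrier (quotient_module R J I)" "y \<in> carrier (quotient_module R J I)"
      "z \<in> carrier (quotient_module R J I)"
    then obtain f g h where *: "f \<in> J" "g \<in> J" "h \<in> J"
      "x = I +>\<^bsub>R\<^esub> f" "y = I +>\<^bsub>R\<^esub> g" "z = I +>\<^bsub>R\<^esub> h" by (auto simp: quotient_module_def)
    moreover have "f \<in> carrier R" "g \<in> carrier R" "h \<in> carrier R" using * sub by auto
    ultimately show "x \<oplus>\<^bsub>quotient_module R J I\<^esub> y \<oplus>\<^bsub>quotient_module R J I\<^esub> z =
        x \<oplus>\<^bsub>quotient_module R J I\<^esub> (y \<oplus>\<^bsub>quotient_module R J I\<^esub> z)"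
      by (simp add: quotient_module_def I.a_rcos_sum R.a_assoc)
  next
    fix x y assume "x \<in> carrier (quotient_module R J I)" "y \<in> carrier (quotient_module R J I)"
    then obtain f g where *: "f \<in> J" "g \<in> J" "x = I +>\<^bsub>R\<^esub> f" "y = I +>\<^bsub>R\<^esub> g"
      by (auto simp: quotient_module_def)
    moreover have "f \<in> carrier R" "g \<in> carrier R" using * sub by auto
    ultimately show "x \<oplus>\<^bsub>quotient_module R J I\<^esub> y \<in> carrier (quotient_module R J I)"
      "x \<oplus>\<^bsub>quotient_module R J I\<^esub> y = y \<oplus>\<^bsub>quotient_module R J I\<^esub> x"
      using J_add[of f g] by (simp_all add: quotient_module_def I.a_rcos_sum R.a_comm)
  qed
  note simps = quotient_module_def I.rcoset_mult_add I.a_rcos_sum R.l_distr R.r_distr R.m_assoc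
  show ?thesis
  proof (rule moduleI)
    fix a b x assume ab: "a \<in> carrier R" "b \<in> carrier R" and "x \<in> carrier (quotient_module R J I)"
    then obtain f where *: "f \<in> J" "x = I +>\<^bsub>R\<^esub> f" by (auto simp: quotient_module_def)
    have c: "f \<in> carrier R" using * sub by auto
    show "(a \<oplus>\<^bsub>R\<^esub> b) \<odot>\<^bsub>quotient_module R J I\<^esub> x = a \<odot>\<^bsub>quotient_module R J I\<^esub> x \<oplus>\<^bsub>quotient_module R J I\<^esub> b \<odot>\<^bsub>quotient_module R J I\<^esub> x" "(a \<otimes>\<^bsub>R\<^esub> b) \<odot>\<^bsub>quotient_module R J I\<^esub> x = a \<odot>\<^bsub>quotient_module R J I\<^esub> (b \<odot>\<^bsub>quotient_module R J I\<^esub> x)"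
      using * ab c by (simp_all add: simps)
  next
    fix a x y assume a: "a \<in> carrier R"
      and "x \<in> carrier (quotient_module R J I)" "y \<in> carrier (quotient_module R J I)"
    then obtain f g where *: "f \<in> J" "g \<in> J" "x = I +>\<^bsub>R\<^esub> f" "y = I +>\<^bsub>R\<^esub> g"
      by (auto simp: quotient_module_def)
    have c: "f \<in> carrier R" "g \<in> carrier R" using * sub by auto
    show "a \<odot>\<^bsub>quotient_module R J I\<^esub> (x \<oplus>\<^bsub>quotient_module R J I\<^esub> y) = a \<odot>\<^bsub>quotient_module R J I\<^esub> x \<oplus>\<^bsub>quotient_module R J I\<^esub> a \<odot>\<^bsub>quotient_module R J I\<^esub> y"
      using * a c by (simp add: simps)
  next
    fix a x assume a: "a \<in> carrier R" and "x \<in> carrier (quotient_module R J I)"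
    then obtain f where *: "f \<in> J" "x = I +>\<^bsub>R\<^esub> f" by (auto simp: quotient_module_def)
    moreover have "f \<in> carrier R" using * sub by auto
    ultimately show "a \<odot>\<^bsub>quotient_module R J I\<^esub> x \<in> carrier (quotient_module R J I)"
      using a J_mult[of a f] by (simp_all add: quotient_module_def I.rcoset_mult_add)
  next
    fix x assume "x \<in> carrier (quotient_module R J I)"
    then obtain f where *: "f \<in> J" "x = I +>\<^bsub>R\<^esub> f" by (auto simp: quotient_module_def)
    moreover have "f \<in> carrier R" using * sub by auto
    ultimately show "\<one>\<^bsub>R\<^esub> \<odot>\<^bsub>quotient_module R J I\<^esub> x = x" by (simp add: quotient_module_def I.rcoset_mult_add)
  qed (fact assms(1) ag)+
qed

lemma sum_keys_single:
  fixes f :: "'k::field mpoly"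
  shows "(\<Sum>t\<in>Poly_Mapping.keys f. Poly_Mapping.single t (Poly_Mapping.lookup f t)) = f"
  by (rule poly_mapping_eqI)
    (simp add: lookup_sum lookup_single when_def in_keys_iff sum.delta)

lemma monomial_ideal_mem_iff:
  assumes "monomial_ideal n I"
  shows "f \<in> I \<longleftrightarrow> f \<in> carrier (poly_ring {1..n}) \<and> 
    (\<forall>t\<in>Poly_Mapping.keys f. Poly_Mapping.single t 1 \<in> I)"
proof -
  let ?R = "poly_ring {1..n} :: 'a mpoly ring"
  interpret cring ?R by (rule poly_ring_cring)
  interpret I: ideal I ?R by (rule monomial_ideal_ideal) fact
  obtain G where G: "G \<subseteq> monomials {1..n}" "I = Idl\<^bsub>?R\<^esub> G"
    using assms unfolding monomial_ideal_def by blast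
  have GI: "G \<subseteq> I" 
  proof -
    have "G \<subseteq> carrier ?R" using G(1) by (auto simp: monomials_def in_poly_ring_iff)
    then show ?thesis using genideal_self G(2) by simp
  qed
  let ?P = "{f \<in> carrier ?R. \<forall>t\<in>Poly_Mapping.keys f. Poly_Mapping.single t 1 \<in> I}"
  have mult: "f * g \<in> ?P" if f: "f \<in> carrier ?R" and g: "g \<in> ?P" for f g
  proof -
    have "Poly_Mapping.single t 1 \<in> I" if t: "t \<in> Poly_Mapping.keys (f * g)" for t
    proof -
      obtain a b where ab: "t = a + b" "a \<in> Poly_Mapping.keys f" "b \<in> Poly_Mapping.keys g"
        using t keys_mult[of f g] by blast
      have "Poly_Mapping.single a 1 * Poly_Mapping.single b 1 \<in> I"
        using I.I_l_closed[of "Poly_Mapping.single b 1" "Poly_Mapping.single a 1"] ab f g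
        by (auto simp: in_poly_ring_iff)
      then show ?thesis by (simp add: ab mult_single)
    qed
    with f g show ?thesis by (simp add: poly_ring_closed)
  qed
  have add: "f + g \<in> ?P" if f: "f \<in> ?P" and g: "g \<in> ?P" for f g
    using f g Poly_Mapping.keys_add[of f g] poly_ring_closed(1)[of f "{1..n}" g] by blast
  have "ideal ?P ?R"
  proof (rule idealI)
    show "subgroup ?P (add_monoid ?R)"
    proof (rule add.subgroupI)
      fix f assume "f \<in> ?P"
      then show "\<ominus>\<^bsub>?R\<^esub> f \<in> ?P" by (auto simp: poly_ring_a_inv keys_uminus poly_ring_closed)
    next
      have "0 \<in> ?P" by (simp add: in_poly_ring_iff)
      then show "?P \<noteq> {}" by blast
      fix f g assume "f \<in> ?P" "g \<in> ?P"
      then show "f \<oplus>\<^bsub>?R\<^esub> g \<in> ?P" using add[of f g] by simp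
    qed blast
    fix f g assume "f \<in> ?P" "g \<in> carrier ?R"
    then show "g \<otimes>\<^bsub>?R\<^esub> f \<in> ?P" "f \<otimes>\<^bsub>?R\<^esub> g \<in> ?P" using mult[of g f] by (simp_all add: mult.commute)
  qed (rule ring_axioms)
  moreover have "G \<subseteq> ?P"
  proof
    fix x assume x: "x \<in> G"
    then obtain t where "x = Poly_Mapping.single t 1" "Poly_Mapping.keys t \<subseteq> {1..n}"
      using G(1) by (auto simp: monomials_def)
    with x GI show "x \<in> ?P" by (auto simp: in_poly_ring_iff)
  qed
  ultimately have "I \<subseteq> ?P" unfolding G(2) by (rule genideal_minimal)
  moreover have "f \<in> I" if f: "f \<in> ?P"
  proof -
    have mem: "Poly_Mapping.single t (Poly_Mapping.lookup f t) \<in> I" if t: "t \<in> Poly_Mapping.keys f" for t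
    proof -
      have "Poly_Mapping.single 0 (Poly_Mapping.lookup f t) * Poly_Mapping.single t 1 \<in> I"
        using I.I_l_closed[of "Poly_Mapping.single t 1" "Poly_Mapping.single 0 (Poly_Mapping.lookup f t)"] f t
        by (auto simp: in_poly_ring_iff split: if_splits)
      then show ?thesis by (simp add: mult_single)
    qed
    have "(\<Sum>t\<in>A. Poly_Mapping.single t (Poly_Mapping.lookup f t)) \<in> I" if "A \<subseteq> Poly_Mapping.keys f" "finite A" for A
      using that(2,1)
    proof induction
      case empty then show ?case using I.zero_closed by simp
    next
      case (insert a A) then show ?case using I.a_closed mem by simp
    qed
    from this[of "Poly_Mapping.keys f"] show ?thesis
      by (simp add: sum_keys_single)
  qed
  ultimately show ?thesis by blast
qed

definition mdeg :: "(nat \<Rightarrow>\<^sub>0 nat) \<Rightarrow> nat \<Rightarrow> int" where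
  "mdeg t i = int (Poly_Mapping.lookup t i)"

lemma mdeg_inject: "mdeg s = mdeg t \<longleftrightarrow> s = t"
  by (auto simp: mdeg_def fun_eq_iff intro: poly_mapping_eqI)

lemma homogeneous_part_alt:
  "homogeneous_part n a = {f \<in> carrier (poly_ring {1..n}). \<forall>t\<in>Poly_Mapping.keys f. mdeg t = a}"
  by (auto simp: homogeneous_part_def mdeg_def fun_eq_iff)

lemma quotient_module_graded:
  fixes I J :: "'k::field mpoly set"
  assumes I: "monomial_ideal n I" and J: "monomial_ideal n J" and IJ: "I \<subseteq> J"
  shows "Zn_graded_module n (quotient_module (poly_ring {1..n}) J I) (quotient_grading n J I)"
proof -
  note One_nat_def [simp del]
  let ?R = "poly_ring {1..n} :: 'k mpoly ring"
  let ?M = "quotient_module ?R J I"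
  let ?gr = "quotient_grading n J I"
  let ?H = "homogeneous_part n :: (nat \<Rightarrow> int) \<Rightarrow> 'k mpoly set"
  let ?c = "\<lambda>g. I +>\<^bsub>?R\<^esub> g"
  interpret R: cring ?R by (rule poly_ring_cring)
  interpret I: ideal I ?R by (rule monomial_ideal_ideal) fact
  interpret J: ideal J ?R by (rule monomial_ideal_ideal) fact
  interpret M: Module.module ?R ?M
    by (rule quotient_module_module) (fact R.is_cring I.ideal_axioms J.ideal_axioms IJ)+
  have M_simps [simp]: "\<zero>\<^bsub>?M\<^esub> = I" "carrier ?M = ?c ` J" "add ?M = set_add ?R" 
    by (simp_all add: quotient_module_def)
  have smult: "f \<odot>\<^bsub>?M\<^esub> ?c g = ?c (f * g)" if "f \<in> carrier ?R" "g \<in> J" for f g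
    using that J.a_subset by (auto simp: quotient_module_def I.rcoset_mult_add subset_iff)
  have Jc: "g \<in> carrier ?R" if "g \<in> J" for g using that J.a_subset by blast
  have c_add: "?c f <+>\<^bsub>?R\<^esub> ?c g = ?c (f + g)" if "f \<in> J" "g \<in> J" for f g
    using that Jc by (simp add: I.a_rcos_sum)
  have c_zero: "?c 0 = I" using R.a_coset_add_zero[OF I.a_subset] by simp
  have c_eq: "?c f = ?c g \<longleftrightarrow> f - g \<in> I" if "f \<in> J" "g \<in> J" for f g
    using R.quotient_eq_iff_same_a_r_cos[OF I.ideal_axioms, of f g] Jc[OF that(1)] Jc[OF that(2)]
    by (simp add: a_minus_def poly_ring_a_inv)
  have J0: "0 \<in> J" using J.zero_closed by simp
  have Jadd: "f + g \<in> J" if "f \<in> J" "g \<in> J" for f g using J.a_closed[OF that] by simp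
  have Jneg: "- f \<in> J" if "f \<in> J" for f using J.a_inv_closed[OF that] Jc[OF that] by (simp add: poly_ring_a_inv)
  have H0: "0 \<in> ?H a" for a by (simp add: homogeneous_part_def in_poly_ring_iff)
  have Hadd: "f + g \<in> ?H a" if "f \<in> ?H a" "g \<in> ?H a" for f g a
    using that Poly_Mapping.keys_add[of f g] by (auto simp: homogeneous_part_def poly_ring_closed)
  have Hneg: "- f \<in> ?H a" if "f \<in> ?H a" for f a
    using that by (auto simp: homogeneous_part_def poly_ring_closed keys_uminus)
  have fin: "finsum ?M (\<lambda>a. ?c (F a)) A = ?c (sum F A) \<and> sum F A \<in> J"
    if "finite A" "\<And>a. a \<in> A \<Longrightarrow> F a \<in> J" for F and A :: "(nat \<Rightarrow> int) set"
    using that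
  proof (induction A)
    case empty then show ?case using c_zero J0 by simp
  next
    case (insert a A)
    then have "finsum ?M (\<lambda>a. ?c (F a)) (insert a A) = ?c (F a) \<oplus>\<^bsub>?M\<^esub> finsum ?M (\<lambda>a. ?c (F a)) A"
      by (intro M.finsum_insert) auto
    with insert show ?case by (simp add: c_add Jadd)
  qed
  have sub: "additive_subgroup (?gr a) ?M" for a
  proof (rule additive_subgroup.intro, rule M.add.subgroupI)
    show "?gr a \<subseteq> carrier ?M" by (auto simp: quotient_grading_def)
    show "?gr a \<noteq> {}" using J0 H0[of a] by (auto simp: quotient_grading_def)
    fix x assume "x \<in> ?gr a"
    then obtain f where f: "f \<in> J" "f \<in> ?H a" "x = ?c f" by (auto simp: quotient_grading_def)
    have "\<ominus>\<^bsub>?M\<^esub> x = ?c (- f)"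
      using f Jneg c_add[of "- f" f] c_zero by (intro M.minus_equality) auto
    then show "\<ominus>\<^bsub>?M\<^esub> x \<in> ?gr a" using f Jneg Hneg by (auto simp: quotient_grading_def)
  next
    fix x y assume "x \<in> ?gr a" "y \<in> ?gr a"
    then obtain f g where fg: "f \<in> J" "f \<in> ?H a" "x = ?c f" "g \<in> J" "g \<in> ?H a" "y = ?c g"
      by (auto simp: quotient_grading_def)
    then have "x \<oplus>\<^bsub>?M\<^esub> y = ?c (f + g)" by (simp add: c_add)
    with fg Jadd Hadd show "x \<oplus>\<^bsub>?M\<^esub> y \<in> ?gr a"
      unfolding quotient_grading_def by blast
  qed
  have ex: "\<exists>y. y \<in> (\<Pi>\<^sub>E a\<in>Zn n. ?gr a) \<and> finite {a\<in>Zn n. y a \<noteq> \<zero>\<^bsub>?M\<^esub>} \<and>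
      x = finsum ?M y {a\<in>Zn n. y a \<noteq> \<zero>\<^bsub>?M\<^esub>}" if xM: "x \<in> carrier ?M" for x
  proof -
    obtain f where f: "f \<in> J" "x = ?c f" using xM by auto
    define A where "A = mdeg ` Poly_Mapping.keys f"
    define F where "F a = (\<Sum>t\<in>{t\<in>Poly_Mapping.keys f. mdeg t = a}. 
      Poly_Mapping.single t (Poly_Mapping.lookup f t))" for a
    have keysF: "Poly_Mapping.keys (F a) \<subseteq> {t\<in>Poly_Mapping.keys f. mdeg t = a}" for a
      unfolding F_def by (rule order.trans[OF keys_sum]) auto
    have FJ: "F a \<in> J" for a
      using f(1) keysF[of a] unfolding monomial_ideal_mem_iff[OF J, of f] monomial_ideal_mem_iff[OF J, of "F a"]
      by (auto simp: in_poly_ring_iff)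
    have FH: "F a \<in> ?H a" for a
      using keysF[of a] Jc[OF FJ[of a]] unfolding homogeneous_part_alt by auto
    have A: "finite A" "A \<subseteq> Zn n"
    proof -
      have "mdeg t \<in> Zn n" if "t \<in> Poly_Mapping.keys f" for t
      proof -
        have "Poly_Mapping.keys t \<subseteq> {1..n}" using Jc[OF f(1)] that by (auto simp: in_poly_ring_iff)
        then have "Poly_Mapping.lookup t i = 0" if "i \<notin> {1..n}" for i
          using that in_keys_iff[of i t] by blast
        then show ?thesis by (simp add: Zn_def mdeg_def)
      qed
      then show "finite A" "A \<subseteq> Zn n" by (auto simp: A_def)
    qed
    have F0: "F a = 0" if "a \<notin> A" for a
    proof -
      have "{t\<in>Poly_Mapping.keys f. mdeg t = a} = {}" using that by (auto simp: A_def)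
      from this show ?thesis unfolding F_def by (simp only: sum.empty)
    qed
    have sumF: "sum F A = f"
      unfolding F_def A_def using sum.image_gen[of "Poly_Mapping.keys f"
        "\<lambda>t. Poly_Mapping.single t (Poly_Mapping.lookup f t)" mdeg]
      by (simp add: sum_keys_single)
    define y where "y = restrict (\<lambda>a. ?c (F a)) (Zn n)"
    have supp: "{a\<in>Zn n. y a \<noteq> I} \<subseteq> A" using F0 c_zero by (auto simp: y_def)
    have "finsum ?M y {a\<in>Zn n. y a \<noteq> I} = finsum ?M (\<lambda>a. ?c (F a)) {a\<in>Zn n. y a \<noteq> I}"
      using FJ by (intro M.finsum_cong') (auto simp: y_def)
    also have "\<dots> = finsum ?M (\<lambda>a. ?c (F a)) A"
      using A supp FJ by (intro M.add.finprod_mono_neutral_cong_left) (auto simp: y_def)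
    also have "\<dots> = x" using fin[of A F] A FJ sumF f by simp
    finally show ?thesis using FJ FH finite_subset[OF supp A(1)]
      by (intro exI[of _ y]) (auto simp: y_def quotient_grading_def)
  qed
  have uniq: "y = z" if
    y: "y \<in> (\<Pi>\<^sub>E a\<in>Zn n. ?gr a)" "finite {a\<in>Zn n. y a \<noteq> I}" and
    z: "z \<in> (\<Pi>\<^sub>E a\<in>Zn n. ?gr a)" "finite {a\<in>Zn n. z a \<noteq> I}" and
    eq: "finsum ?M y {a\<in>Zn n. y a \<noteq> I} = finsum ?M z {a\<in>Zn n. z a \<noteq> I}" for y z
  proof -
    define B where "B = {a\<in>Zn n. y a \<noteq> I} \<union> {a\<in>Zn n. z a \<noteq> I}"
    have B: "finite B" "B \<subseteq> Zn n" using y z by (auto simp: B_def)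
    have "\<forall>a\<in>Zn n. \<exists>f. f \<in> J \<inter> ?H a \<and> y a = ?c f"
      by (rule ballI, drule PiE_mem[OF y(1)]) (auto simp: quotient_grading_def)
    from bchoice[OF this] obtain F where F: "\<And>a. a \<in> Zn n \<Longrightarrow> F a \<in> J" "\<And>a. a \<in> Zn n \<Longrightarrow> F a \<in> ?H a" 
      "\<And>a. a \<in> Zn n \<Longrightarrow> y a = ?c (F a)" by blast
    have "\<forall>a\<in>Zn n. \<exists>f. f \<in> J \<inter> ?H a \<and> z a = ?c f"
      by (rule ballI, drule PiE_mem[OF z(1)]) (auto simp: quotient_grading_def)
    from bchoice[OF this] obtain G where G: "\<And>a. a \<in> Zn n \<Longrightarrow> G a \<in> J" "\<And>a. a \<in> Zn n \<Longrightarrow> G a \<in> ?H a" 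
      "\<And>a. a \<in> Zn n \<Longrightarrow> z a = ?c (G a)" by blast
    have "finsum ?M y {a\<in>Zn n. y a \<noteq> I} = finsum ?M (\<lambda>a. ?c (F a)) B"
      using B F by (intro M.add.finprod_mono_neutral_cong_left) (auto simp: B_def)
    then have 1: "finsum ?M y {a\<in>Zn n. y a \<noteq> I} = ?c (sum F B)" "sum F B \<in> J"
      using fin[of B F] B F(1) by auto
    have "finsum ?M z {a\<in>Zn n. z a \<noteq> I} = finsum ?M (\<lambda>a. ?c (G a)) B"
      using B G by (intro M.add.finprod_mono_neutral_cong_left) (auto simp: B_def)
    then have 2: "finsum ?M z {a\<in>Zn n. z a \<noteq> I} = ?c (sum G B)" "sum G B \<in> J"
      using fin[of B G] B G(1) by auto
    have "sum F B - sum G B \<in> I" using c_eq[of "sum F B" "sum G B"] 1 2 eq by simp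
    then have D: "(\<Sum>a\<in>B. F a - G a) \<in> I" by (simp add: sum_subtractf)
    have "y a = z a" if a: "a \<in> B" for a
    proof -
      have aZ: "a \<in> Zn n" using a B by blast
      have FG: "F b - G b \<in> ?H b" if "b \<in> Zn n" for b
        using Hadd[OF F(2) Hneg[OF G(2)], OF that that] by simp
      have FGJ: "F a - G a \<in> J" using Jadd[OF F(1) Jneg[OF G(1)], OF aZ aZ] by simp
      have "F a - G a \<in> I"
        unfolding monomial_ideal_mem_iff[OF I, of "F a - G a"]
      proof (intro conjI ballI)
        show "F a - G a \<in> carrier ?R" using FGJ Jc by blast
        fix t assume t: "t \<in> Poly_Mapping.keys (F a - G a)"
        then have ta: "mdeg t = a" using FG[OF aZ] by (auto simp: homogeneous_part_alt)
        have "Poly_Mapping.lookup (F b - G b) t = 0" if "b \<in> B" "b \<noteq> a" for b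
        proof -
          have "b \<in> Zn n" using that B by blast
          from FG[OF this] that ta show ?thesis by (auto simp: homogeneous_part_alt in_keys_iff)
        qed
        then have "Poly_Mapping.lookup (\<Sum>b\<in>B. F b - G b) t = Poly_Mapping.lookup (F a - G a) t"
          unfolding lookup_sum using B a by (subst sum.remove[of _ a]) (auto intro!: sum.neutral)
        then have "t \<in> Poly_Mapping.keys (\<Sum>b\<in>B. F b - G b)" using t by (simp add: in_keys_iff)
        then show "Poly_Mapping.single t 1 \<in> I"
          using D unfolding monomial_ideal_mem_iff[OF I, of "\<Sum>b\<in>B. F b - G b"] by blast
      qed
      then show ?thesis using F G aZ c_eq by auto
    qed
    moreover have "y a = z a" if "a \<in> Zn n" "a \<notin> B" for a using that by (auto simp: B_def)
    ultimately have "y a = z a" if "a \<in> Zn n" for a using that by blast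
    with y(1) z(1) show "y = z" by (rule PiE_ext)
  qed
  show ?thesis
  proof (intro Zn_graded_module.intro Zn_graded_module_axioms.intro)
    show "Module.module ?R ?M" by (rule M.module_axioms)
    show "internal_direct_sum ?M (Zn n) ?gr"
      unfolding internal_direct_sum_def
    proof (intro conjI ballI)
      fix x assume x: "x \<in> carrier ?M"
      show "\<exists>!y. y \<in> (\<Pi>\<^sub>E a\<in>Zn n. ?gr a) \<and> finite {a\<in>Zn n. y a \<noteq> \<zero>\<^bsub>?M\<^esub>} \<and>
        x = finsum ?M y {a\<in>Zn n. y a \<noteq> \<zero>\<^bsub>?M\<^esub>}"
      proof (rule ex_ex1I)
        show "\<exists>y. y \<in> (\<Pi>\<^sub>E a\<in>Zn n. ?gr a) \<and> finite {a\<in>Zn n. y a \<noteq> \<zero>\<^bsub>?M\<^esub>} \<and>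
          x = finsum ?M y {a\<in>Zn n. y a \<noteq> \<zero>\<^bsub>?M\<^esub>}" by (rule ex) (rule x)
      next
        fix y z
        assume "y \<in> (\<Pi>\<^sub>E a\<in>Zn n. ?gr a) \<and> finite {a\<in>Zn n. y a \<noteq> \<zero>\<^bsub>?M\<^esub>} \<and>
          x = finsum ?M y {a\<in>Zn n. y a \<noteq> \<zero>\<^bsub>?M\<^esub>}"
          and "z \<in> (\<Pi>\<^sub>E a\<in>Zn n. ?gr a) \<and> finite {a\<in>Zn n. z a \<noteq> \<zero>\<^bsub>?M\<^esub>} \<and>
          x = finsum ?M z {a\<in>Zn n. z a \<noteq> \<zero>\<^bsub>?M\<^esub>}"
        then show "y = z" unfolding M_simps by (elim conjE) (rule uniq, assumption+, simp only:)
      qed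
    qed (rule sub)
    fix a b f x assume "a \<in> Zn n" "b \<in> Zn n" and f: "f \<in> ?H a" and x: "x \<in> ?gr b"
    obtain g where g: "g \<in> J" "g \<in> ?H b" "x = ?c g" using x by (auto simp: quotient_grading_def)
    have fc: "f \<in> carrier ?R" using f by (simp add: homogeneous_part_def)
    have fg: "f * g \<in> J" using J.I_l_closed[OF g(1) fc] by simp
    have "f * g \<in> ?H (\<lambda>i. a i + b i)"
      unfolding homogeneous_part_def
    proof (intro CollectI conjI ballI allI)
      show "f * g \<in> carrier ?R" by (rule Jc) (rule fg)
      fix t i assume "t \<in> Poly_Mapping.keys (f * g)"
      then obtain t1 t2 where t: "t = t1 + t2" "t1 \<in> Poly_Mapping.keys f" "t2 \<in> Poly_Mapping.keys g"
        using keys_mult[of f g] by blast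
      with f g(2) show "int (Poly_Mapping.lookup t i) = a i + b i"
        by (simp add: homogeneous_part_def lookup_add)
    qed
    with fg smult[OF fc g(1)] g(3) show "f \<odot>\<^bsub>?M\<^esub> x \<in> ?gr (\<lambda>i. a i + b i)"
      by (auto simp: quotient_grading_def)
  qed
qed

end

theory Submission
  imports Defs "HOL-Library.Disjoint_Sets"
begin

text \<open>
  The monomials in \<open>J\<close> but not in \<open>I\<close> are those divisible by one of the \<open>N = q - r\<close> generators
  \<open>u\<^sub>i\<close> with \<open>i > r\<close> and by none of the \<open>v\<^sub>j\<close>. Removing the multiples of one monomial from a Stanley
  space \<open>a K[Z]\<close> leaves Stanley spaces of dimension at least \<open>|Z| - 1\<close>, so removing the \<open>p\<close> monomials
  \<open>v\<^sub>j\<close> costs \<open>p\<close> dimensions. For the multiples of some \<open>u\<^sub>i\<close>, partition the nonempty subsets of an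
  \<open>N\<close>-element set into intervals \<open>[A, B]\<close> with \<open>N - |B| \<le> N / 2\<close>: the monomials \<open>w\<close> with
  \<open>A \<subseteq> {i. u\<^sub>i | w} \<subseteq> B\<close> are the multiples of \<open>lcm {u\<^sub>i | i \<in> A}\<close> avoiding \<open>N - |B|\<close> monomials.

  Such a partition is obtained as follows. Given a nonempty \<open>C\<close>, let \<open>e\<close> be the parity of its maximum,
  let \<open>a\<^sub>1\<close> be the first element of \<open>C\<close> of parity \<open>e\<close>, and let \<open>a\<^sub>k\<^sub>+\<^sub>1\<close> be the first element of \<open>C\<close>
  after \<open>a\<^sub>k\<close> whose parity differs from that of \<open>a\<^sub>k\<close>. The sets with given \<open>e\<close> and \<open>A = {a\<^sub>1, \<dots>}\<close> form
  an interval, whose upper end omits at most half of the \<open>N\<close> positions.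
\<close>

section \<open>Divisibility of monomials and the exponent sets of Stanley spaces\<close>

definition monomial_dvd :: "(nat \<Rightarrow>\<^sub>0 nat) \<Rightarrow> (nat \<Rightarrow>\<^sub>0 nat) \<Rightarrow> bool" where
  "monomial_dvd a w \<longleftrightarrow> (\<forall>x. Poly_Mapping.lookup a x \<le> Poly_Mapping.lookup w x)"

text \<open>Monomials are handled through their exponent vectors. A block is the monomial basis of
  the Stanley space \<open>a K[Z]\<close>, so that direct sums of Stanley spaces become disjoint
  unions of sets.\<close>

definition stanley_block :: "(nat \<Rightarrow>\<^sub>0 nat) \<Rightarrow> nat set \<Rightarrow> (nat \<Rightarrow>\<^sub>0 nat) set" where
  "stanley_block a Z = {a + c | c. Poly_Mapping.keys c \<subseteq> Z}"

lemma monomial_dvd_iff_add: "monomial_dvd a w \<longleftrightarrow> (\<exists>c. w = a + c)"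
proof
  assume "monomial_dvd a w"
  then have "w = a + (w - a)"
    by (intro poly_mapping_eqI) (simp add: monomial_dvd_def lookup_add lookup_minus)
  then show "\<exists>c. w = a + c" ..
qed (auto simp: monomial_dvd_def lookup_add)

lemma stanley_block_iff:
  "w \<in> stanley_block a Z \<longleftrightarrow>
     monomial_dvd a w \<and> (\<forall>x. x \<notin> Z \<longrightarrow> Poly_Mapping.lookup w x = Poly_Mapping.lookup a x)"
proof
  assume "w \<in> stanley_block a Z"
  then show "monomial_dvd a w \<and> (\<forall>x. x \<notin> Z \<longrightarrow> Poly_Mapping.lookup w x = Poly_Mapping.lookup a x)"
    by (auto simp: stanley_block_def monomial_dvd_def lookup_add in_keys_iff subset_iff)
next
  assume *: "monomial_dvd a w \<and> (\<forall>x. x \<notin> Z \<longrightarrow> Poly_Mapping.lookup w x = Poly_Mapping.lookup a x)"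
  then obtain c where "w = a + c" by (auto simp: monomial_dvd_iff_add)
  with * show "w \<in> stanley_block a Z"
    by (auto simp: stanley_block_def lookup_add in_keys_iff)
qed

lemma stanley_block_self: "a \<in> stanley_block a Z"
  by (simp add: stanley_block_iff monomial_dvd_def)

lemma stanley_block_UNIV: "stanley_block 0 Z = {w. Poly_Mapping.keys w \<subseteq> Z}"
  by (simp add: stanley_block_def)

text \<open>The exponent of \<open>x\<close> either equals that of \<open>a\<close> or exceeds it,
  as in \<open>K[Z] = K[Z - {x}] + x K[Z]\<close>.\<close>

lemma stanley_block_split:
  assumes "x \<in> Z"
  shows "stanley_block a Z =
    stanley_block a (Z - {x}) \<union> stanley_block (a + Poly_Mapping.single x 1) Z"
    and "stanley_block a (Z - {x}) \<inter> stanley_block (a + Poly_Mapping.single x 1) Z = {}"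
proof -
  have iff: "w \<in> stanley_block a (Z - {x}) \<longleftrightarrow>
      w \<in> stanley_block a Z \<and> Poly_Mapping.lookup w x = Poly_Mapping.lookup a x"
    "w \<in> stanley_block (a + Poly_Mapping.single x 1) Z \<longleftrightarrow>
      w \<in> stanley_block a Z \<and> Poly_Mapping.lookup a x < Poly_Mapping.lookup w x" for w
    using assms
    by (auto simp: stanley_block_iff monomial_dvd_def lookup_add lookup_single when_def
        Suc_le_eq order.strict_implies_order split: if_splits)
  have "Poly_Mapping.lookup a x \<le> Poly_Mapping.lookup w x" if "w \<in> stanley_block a Z" for w
    using that by (simp add: stanley_block_iff monomial_dvd_def)
  then show "stanley_block a Z =
    stanley_block a (Z - {x}) \<union> stanley_block (a + Poly_Mapping.single x 1) Z"
    unfolding set_eq_iff Un_iff iff using le_less by metis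
  show "stanley_block a (Z - {x}) \<inter> stanley_block (a + Poly_Mapping.single x 1) Z = {}"
    by (auto simp: iff simp del: One_nat_def)
qed

section \<open>Partitions into blocks with bounded loss of dimension\<close>

text \<open>
  The number \<open>d\<close> is the allowed loss of dimension. It is an integer because the empty set may
  be given a negative loss, which starts the induction in \<open>parity_state_partition\<close>.
\<close>

inductive stanley_partition :: "nat \<Rightarrow> int \<Rightarrow> (nat \<Rightarrow>\<^sub>0 nat) set \<Rightarrow> bool" for n d where
  empty: "stanley_partition n d {}"
| block: "\<lbrakk>Poly_Mapping.keys a \<subseteq> {1..n}; Z \<subseteq> {1..n}; int n \<le> int (card Z) + d\<rbrakk>
    \<Longrightarrow> stanley_partition n d (stanley_block a Z)"
| union: "\<lbrakk>stanley_partition n d X; stanley_partition n d Y; X \<inter> Y = {}\<rbrakk>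
    \<Longrightarrow> stanley_partition n d (X \<union> Y)"

lemma stanley_partition_mono:
  assumes "stanley_partition n d X" "d \<le> d'"
  shows "stanley_partition n d' X"
  using assms(1)
proof induction
  case (block a Z)
  with assms(2) show ?case by (intro stanley_partition.block) auto
qed (auto intro: stanley_partition.intros)

text \<open>Induction on the degree that \<open>a\<close> lacks to be a multiple of \<open>v\<close>
  (the subtraction is truncated). While \<open>a\<close> lacks some \<open>x\<close> in
  \<open>Z\<close>, the slice with the least exponent of \<open>x\<close> contains no multiple of
  \<open>v\<close> and is split off; the rest is a block over the same \<open>Z\<close>. So each
  slice misses only one variable of \<open>Z\<close>, and the multiples of \<open>v\<close> lose
  none.\<close>

lemma stanley_block_multiples:
  assumes "Poly_Mapping.keys a \<subseteq> {1..n}" "Z \<subseteq> {1..n}" "int n \<le> int (card Z) + d"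
  shows "stanley_partition n d {w \<in> stanley_block a Z. monomial_dvd v w} \<and>
    stanley_partition n (d + 1) {w \<in> stanley_block a Z. \<not> monomial_dvd v w}"
  using assms
proof (induction "\<Sum>x\<in>Poly_Mapping.keys v. Poly_Mapping.lookup v x - Poly_Mapping.lookup a x"
    arbitrary: a rule: less_induct)
  case (less a)
  have block: "stanley_partition n d (stanley_block a Z)" by (rule stanley_partition.block) fact+
  show ?case
  proof (cases "monomial_dvd v a")
    case True
    then have "monomial_dvd v w" if "w \<in> stanley_block a Z" for w
      using that by (meson monomial_dvd_def order_trans stanley_block_iff)
    then have "{w \<in> stanley_block a Z. monomial_dvd v w} = stanley_block a Z"
      "{w \<in> stanley_block a Z. \<not> monomial_dvd v w} = {}" by auto
    then show ?thesis using block by (simp only: stanley_partition.empty)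
  next
    case False
    then obtain x where x: "Poly_Mapping.lookup a x < Poly_Mapping.lookup v x"
      by (auto simp: monomial_dvd_def not_le)
    \<comment> \<open>Used with \<open>W = Z\<close> when the exponent of \<open>x\<close> cannot
      grow, and with \<open>W = Z - {x}\<close> for the slice that is split off.\<close>
    have small: "\<not> monomial_dvd v w" if "w \<in> stanley_block a W" "x \<notin> W" for w W
      using that x by (metis monomial_dvd_def not_le stanley_block_iff)
    show ?thesis
    proof (cases "x \<in> Z")
      case False
      then have "{w \<in> stanley_block a Z. monomial_dvd v w} = {}"
        "{w \<in> stanley_block a Z. \<not> monomial_dvd v w} = stanley_block a Z"
        using small[of _ Z] by auto
      moreover have "stanley_partition n (d + 1) (stanley_block a Z)"
        by (rule stanley_partition_mono[OF block]) simp
      ultimately show ?thesis by (simp only: stanley_partition.empty simp_thms)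
    next
      case True
      let ?a = "a + Poly_Mapping.single x 1"
      let ?f = "\<lambda>a y. Poly_Mapping.lookup v y - Poly_Mapping.lookup a y"
      have "sum (?f ?a) (Poly_Mapping.keys v) < sum (?f a) (Poly_Mapping.keys v)"
      proof (rule sum_strict_mono_ex1)
        show "\<exists>y\<in>Poly_Mapping.keys v. ?f ?a y < ?f a y"
          using x by (intro bexI[of _ x]) (auto simp: lookup_add in_keys_iff)
      qed (auto simp: lookup_add)
      moreover have "Poly_Mapping.keys ?a \<subseteq> {1..n}"
        using less.prems(1,2) True Poly_Mapping.keys_add[of a "Poly_Mapping.single x 1"]
        by (auto split: if_splits)
      ultimately have IH: "stanley_partition n d {w \<in> stanley_block ?a Z. monomial_dvd v w}"
          "stanley_partition n (d + 1) {w \<in> stanley_block ?a Z. \<not> monomial_dvd v w}"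
        using less.hyps less.prems by blast+
      have "finite Z" using less.prems(2) finite_subset by blast
      then have "stanley_partition n (d + 1) (stanley_block a (Z - {x}))"
        using less.prems True by (intro stanley_partition.block) (auto simp: card_Diff_singleton)
      from stanley_partition.union[OF this IH(2)]
      have "stanley_partition n (d + 1)
          (stanley_block a (Z - {x}) \<union> {w \<in> stanley_block ?a Z. \<not> monomial_dvd v w})"
        using stanley_block_split(2)[OF True, of a] by blast
      moreover have "stanley_block a (Z - {x}) \<union> {w \<in> stanley_block ?a Z. \<not> monomial_dvd v w} =
          {w \<in> stanley_block a Z. \<not> monomial_dvd v w}"
        "{w \<in> stanley_block ?a Z. monomial_dvd v w} = {w \<in> stanley_block a Z. monomial_dvd v w}"
        using small[of _ "Z - {x}"] stanley_block_split(1)[OF True, of a] by blast+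
      ultimately show ?thesis using IH(1) by (simp only: simp_thms)
    qed
  qed
qed

lemma stanley_partition_multiples:
  assumes "stanley_partition n d X"
  shows "stanley_partition n d {w \<in> X. monomial_dvd v w}"
  using assms
proof induction
  case (union X Y)
  have "{w \<in> X \<union> Y. monomial_dvd v w} = {w \<in> X. monomial_dvd v w} \<union> {w \<in> Y. monomial_dvd v w}"
    by auto
  with union show ?case by (auto intro: stanley_partition.union)
qed (simp_all add: stanley_partition.empty stanley_block_multiples)

lemma stanley_partition_nonmultiples:
  assumes "stanley_partition n d X"
  shows "stanley_partition n (d + 1) {w \<in> X. \<not> monomial_dvd v w}"
  using assms
proof induction
  case (union X Y)
  have "{w \<in> X \<union> Y. \<not> monomial_dvd v w} = {w \<in> X. \<not> monomial_dvd v w} \<union> {w \<in> Y. \<not> monomial_dvd v w}"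
    by auto
  with union show ?case by (auto intro: stanley_partition.union)
qed (simp_all add: stanley_partition.empty stanley_block_multiples)

lemma stanley_partition_avoid:
  assumes "stanley_partition n d X"
  shows "stanley_partition n (d + int p) {w \<in> X. \<forall>j\<in>{1..p}. \<not> monomial_dvd (v j) w}"
proof (induction p)
  case 0
  show ?case using assms by simp
next
  case (Suc p)
  have "{w \<in> X. \<forall>j\<in>{1..Suc p}. \<not> monomial_dvd (v j) w} =
      {w \<in> {w \<in> X. \<forall>j\<in>{1..p}. \<not> monomial_dvd (v j) w}. \<not> monomial_dvd (v (Suc p)) w}"
    by (auto simp: atLeastAtMostSuc_conv)
  with stanley_partition_nonmultiples[OF Suc, of "v (Suc p)"] show ?case by (simp add: add_ac)
qed

section \<open>The greedy parity scan over the generators\<close>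

text \<open>
  The state of the greedy scan for parity \<open>e\<close>, after the positions below \<open>N\<close>: 0 if no element of parity
  \<open>e\<close> has occurred, and otherwise 1 or 2 according to whether the last element has parity \<open>e\<close> or not.
\<close>

fun parity_state :: "(nat \<Rightarrow> bool) \<Rightarrow> nat \<Rightarrow> nat \<Rightarrow> nat" where
  "parity_state U e 0 = 0"
| "parity_state U e (Suc N) =
    (if U N then if even (N + e) then 1 else if parity_state U e N = 0 then 0 else 2
     else parity_state U e N)"

text \<open>The state for \<open>e\<close> is 1 exactly when there is a last position satisfying
  \<open>U\<close> and it has the parity of \<open>e\<close>.\<close>

lemma parity_state_eq_1:
  "(\<exists>i<N. U i) \<longleftrightarrow> parity_state U 0 N = 1 \<or> parity_state U 1 N = 1"
  "\<not> (parity_state U 0 N = 1 \<and> parity_state U 1 N = 1)"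
  by (induction N) (auto simp: less_Suc_eq split: if_splits)

lemma parity_state_less_3: "parity_state U e N < 3"
  by (induction N) auto

text \<open>At position \<open>N\<close> a state set is split, and its nonmultiples of
  \<open>u N\<close> pay one dimension, only if divisibility by \<open>u N\<close> changes the
  state. At positions of the parity of \<open>e\<close> this concerns states 0 and 2, at the other
  positions state 1. Hence each bound grows by one at every second position, which the divisions by
  2 record.\<close>

lemma parity_state_partition:
  fixes n :: nat and u :: "nat \<Rightarrow> nat \<Rightarrow>\<^sub>0 nat"
  assumes "e \<le> 1"
  defines "X \<equiv> \<lambda>N s. {w. Poly_Mapping.keys w \<subseteq> {1..n} \<and> parity_state (\<lambda>i. monomial_dvd (u i) w) e N = s}"
  shows "stanley_partition n ((int N + 1 - int e) div 2) (X N 0) \<and>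
    stanley_partition n ((int N - int e) div 2) (X N 1) \<and>
    stanley_partition n ((int N - 1 - int e) div 2) (X N 2)"
proof (induction N)
  case 0
  have "X 0 0 = stanley_block 0 {1..n}" "X 0 1 = {}" "X 0 2 = {}"
    by (auto simp: X_def stanley_block_UNIV)
  moreover have "(1 - int e) div 2 = 0" using assms(1) by auto
  ultimately show ?case by (auto intro!: stanley_partition.intros)
next
  case (Suc N)
  let ?M = "\<lambda>A. {w \<in> A. monomial_dvd (u N) w}"
  let ?O = "\<lambda>A. {w \<in> A. \<not> monomial_dvd (u N) w}"
  note IH = Suc[THEN conjunct1] Suc[THEN conjunct2, THEN conjunct1] Suc[THEN conjunct2, THEN conjunct2]
  note M = IH[THEN stanley_partition_multiples, of "u N"]
  note O = IH[THEN stanley_partition_nonmultiples, of "u N"]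
  \<comment> \<open>There are only three states, so excluding 0 and 2 leaves 1; \<open>Suc 0\<close>
    is the form in which \<open>auto\<close> meets it.\<close>
  have state_1: "parity_state (\<lambda>i. monomial_dvd (u i) w) e N = Suc 0"
    if "parity_state (\<lambda>i. monomial_dvd (u i) w) e N \<noteq> 2" "0 < parity_state (\<lambda>i. monomial_dvd (u i) w) e N"
    for w :: "nat \<Rightarrow>\<^sub>0 nat"
    using that parity_state_less_3[of "\<lambda>i. monomial_dvd (u i) w" e N] by linarith
  have disj: "X N s \<inter> X N s' = {}" if "s \<noteq> s'" for s s' using that by (auto simp: X_def)
  show ?case
  proof (cases "even (N + e)")
    case True
    have X: "X (Suc N) 0 = ?O (X N 0)" "X (Suc N) 1 = ?M (X N 0) \<union> X N 1 \<union> ?M (X N 2)"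
      "X (Suc N) 2 = ?O (X N 2)"
      using True by (auto simp: X_def intro: state_1)
    have "\<exists>k. int N = 2 * k + int e" using True by presburger
    then obtain k where "int N = 2 * k + int e" ..
    then have d: "(int N + 1 - int e) div 2 = k" "(int N - int e) div 2 = k" "(int N - 1 - int e) div 2 = k - 1"
      "(int (Suc N) + 1 - int e) div 2 = k + 1" "(int (Suc N) - int e) div 2 = k" "(int (Suc N) - 1 - int e) div 2 = k"
      by simp_all
    \<comment> \<open>State 1 absorbs both outcomes here, so \<open>X N 1\<close> stays unsplit. The
      part coming from state 2 has the smaller loss \<open>k - 1\<close>.\<close>
    have "stanley_partition n k (?M (X N 0) \<union> X N 1 \<union> ?M (X N 2))"
      using M IH disj[of 0 1] disj[of 0 2] disj[of 1 2] unfolding d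
      by (intro stanley_partition.union) (auto intro: stanley_partition_mono)
    then show ?thesis unfolding X d using O unfolding d by simp
  next
    case False
    have X: "X (Suc N) 0 = X N 0" "X (Suc N) 1 = ?O (X N 1)" "X (Suc N) 2 = ?M (X N 1) \<union> X N 2"
      using False by (auto simp: X_def intro: state_1)
    have "\<exists>k. int N = 2 * k + 1 + int e" using False by presburger
    \<comment> \<open>For \<open>N = 0\<close> and \<open>e = 1\<close> this \<open>k\<close> is -1,
      so it has to be an integer.\<close>
    then obtain k where "int N = 2 * k + 1 + int e" ..
    then have d: "(int N + 1 - int e) div 2 = k + 1" "(int N - int e) div 2 = k" "(int N - 1 - int e) div 2 = k"
      "(int (Suc N) + 1 - int e) div 2 = k + 1" "(int (Suc N) - int e) div 2 = k + 1" "(int (Suc N) - 1 - int e) div 2 = k"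
      by simp_all
    have "stanley_partition n k (?M (X N 1) \<union> X N 2)"
      using M IH disj[of 1 2] unfolding d
      by (intro stanley_partition.union) auto
    then show ?thesis unfolding X d using O IH unfolding d by simp
  qed
qed

text \<open>The parity of the last \<open>i < N\<close> with \<open>u i\<close> dividing
  \<open>w\<close> sorts these monomials into the state 1 sets for \<open>e = 0\<close> and
  \<open>e = 1\<close>. Their losses are \<open>N div 2\<close> and \<open>(N - 1) div 2\<close>,
  and the larger one counts.\<close>

lemma stanley_partition_some_multiple:
  "stanley_partition n (int N div 2) {w. Poly_Mapping.keys w \<subseteq> {1..n} \<and> (\<exists>i<N. monomial_dvd (u i) w)}"
proof -
  let ?X = "\<lambda>e. {w. Poly_Mapping.keys w \<subseteq> {1..n} \<and> parity_state (\<lambda>i. monomial_dvd (u i) w) e N = 1}"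
  have "stanley_partition n (int N div 2) (?X 0)" "stanley_partition n (int N div 2) (?X 1)"
    using parity_state_partition[of 0 n N u]
      stanley_partition_mono[of n "(int N - 1) div 2" "?X 1" "int N div 2"] parity_state_partition[of 1 n N u]
    by simp_all
  then have "stanley_partition n (int N div 2) (?X 0 \<union> ?X 1)"
    using parity_state_eq_1(2) by (intro stanley_partition.union) blast+
  also have "?X 0 \<union> ?X 1 = {w. Poly_Mapping.keys w \<subseteq> {1..n} \<and> (\<exists>i<N. monomial_dvd (u i) w)}"
    unfolding parity_state_eq_1(1) by blast
  finally show ?thesis .
qed

section \<open>Blocks as a numbered disjoint family\<close>

text \<open>\<open>stanley_decomposition\<close> needs summands numbered from 1 to \<open>s\<close>.
  The induction collects a finite set of pairs \<open>(a, Z)\<close>, so that the union step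
  requires no renumbering; a bijection numbers the pairs once at the end.\<close>

lemma stanley_partition_imp_blocks:
  assumes "stanley_partition n d X"
  obtains s a Z where
    "\<forall>i\<in>{1..s}. Poly_Mapping.keys (a i) \<subseteq> {1..n} \<and> Z i \<subseteq> {1..n} \<and> int n \<le> int (card (Z i)) + d"
    "disjoint_family_on (\<lambda>i. stanley_block (a i) (Z i)) {1..s}"
    "(\<Union>i\<in>{1..s::nat}. stanley_block (a i) (Z i)) = X"
proof -
  have "\<exists>P. finite P \<and> \<Union> (case_prod stanley_block ` P) = X \<and>
    (\<forall>(a, Z)\<in>P. Poly_Mapping.keys a \<subseteq> {1..n} \<and> Z \<subseteq> {1..n} \<and> int n \<le> int (card Z) + d) \<and>
    disjoint_family_on (case_prod stanley_block) P"
    using assms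
  proof induction
    case empty
    show ?case by (intro exI[of _ "{}"]) (simp add: disjoint_family_on_def)
  next
    case (block a Z)
    then show ?case by (intro exI[of _ "{(a, Z)}"]) (simp add: disjoint_family_on_def)
  next
    case (union X Y)
    from union.IH(1) obtain P where P: "finite P" "\<Union> (case_prod stanley_block ` P) = X"
      "\<forall>(a, Z)\<in>P. Poly_Mapping.keys a \<subseteq> {1..n} \<and> Z \<subseteq> {1..n} \<and> int n \<le> int (card Z) + d"
      "disjoint_family_on (case_prod stanley_block) P" by (elim exE conjE)
    from union.IH(2) obtain Q where Q: "finite Q" "\<Union> (case_prod stanley_block ` Q) = Y"
      "\<forall>(a, Z)\<in>Q. Poly_Mapping.keys a \<subseteq> {1..n} \<and> Z \<subseteq> {1..n} \<and> int n \<le> int (card Z) + d"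
      "disjoint_family_on (case_prod stanley_block) Q" by (elim exE conjE)
    have "disjoint_family_on B (P \<union> Q)" if "disjoint_family_on B P" "disjoint_family_on B Q"
      "\<Union> (B ` P) \<inter> \<Union> (B ` Q) = {}" for B :: "(nat \<Rightarrow>\<^sub>0 nat) \<times> nat set \<Rightarrow> (nat \<Rightarrow>\<^sub>0 nat) set"
      using that unfolding disjoint_family_on_def by blast
    from this[OF P(4) Q(4)] have "disjoint_family_on (case_prod stanley_block) (P \<union> Q)"
      unfolding P(2) Q(2) using union.hyps(3) .
    then show ?case using P(1-3) Q(1-3)
      by (intro exI[of _ "P \<union> Q"]) (simp add: ball_Un image_Un Union_Un_distrib)
  qed
  then obtain P where P: "finite P" "\<Union> (case_prod stanley_block ` P) = X"
    "\<forall>(a, Z)\<in>P. Poly_Mapping.keys a \<subseteq> {1..n} \<and> Z \<subseteq> {1..n} \<and> int n \<le> int (card Z) + d"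
    "disjoint_family_on (case_prod stanley_block) P" by (elim exE conjE)
  obtain h where h: "bij_betw h {1..card P} P"
    using ex_bij_betw_nat_finite_1[OF P(1)] by blast
  then have hP: "h i \<in> P" if "i \<in> {1..card P}" for i using that by (rule bij_betwE[rule_format])
  have h_img: "h ` {1..card P} = P" and h_inj: "inj_on h {1..card P}" using h by (simp_all add: bij_betw_def)
  let ?B = "\<lambda>i. stanley_block (fst (h i)) (snd (h i))"
  have B: "?B = (\<lambda>i. case_prod stanley_block (h i))" by (simp add: case_prod_beta)
  show ?thesis
  proof (rule that)
    show "\<forall>i\<in>{1..card P}. Poly_Mapping.keys (fst (h i)) \<subseteq> {1..n} \<and> snd (h i) \<subseteq> {1..n} \<and>
        int n \<le> int (card (snd (h i))) + d"
      using P(3) hP by (metis (no_types, lifting) case_prod_beta)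
    show "disjoint_family_on ?B {1..card P}"
      unfolding disjoint_family_on_def B
    proof (intro ballI impI)
      fix i j assume ij: "i \<in> {1..card P}" "j \<in> {1..card P}" "i \<noteq> j"
      then have "h i \<noteq> h j" using h_inj by (meson inj_onD)
      then show "case_prod stanley_block (h i) \<inter> case_prod stanley_block (h j) = {}"
        using P(4) hP[OF ij(1)] hP[OF ij(2)] unfolding disjoint_family_on_def by simp
    qed
    have "(\<Union>i\<in>{1..card P}. ?B i) = \<Union> (case_prod stanley_block ` h ` {1..card P})"
      unfolding B image_image ..
    then show "(\<Union>i\<in>{1..card P}. ?B i) = X" unfolding h_img P(2) .
  qed
qed

section \<open>Monomial ideals and the decomposition of J/I\<close>

text \<open>The polynomials all of whose monomials are divisible by a generator form an ideal
  containing \<open>G\<close>, hence containing the generated ideal.\<close>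

lemma monomial_mem_genideal_iff:
  fixes G :: "'k::field mpoly set"
  assumes G: "G \<subseteq> monomials {1..n}"
  shows "Poly_Mapping.single w 1 \<in> Idl\<^bsub>poly_ring {1..n}\<^esub> G \<longleftrightarrow>
    Poly_Mapping.keys w \<subseteq> {1..n} \<and> (\<exists>t. Poly_Mapping.single t 1 \<in> G \<and> monomial_dvd t w)"
proof -
  let ?R = "poly_ring {1..n} :: 'k mpoly ring"
  let ?D = "\<lambda>w. \<exists>t. Poly_Mapping.single t (1::'k) \<in> G \<and> monomial_dvd t w"
  let ?P = "{f \<in> carrier ?R. \<forall>t\<in>Poly_Mapping.keys f. ?D t}"
  interpret R: cring ?R by (rule poly_ring_cring)
  have Gc: "G \<subseteq> carrier ?R" using G by (auto simp: monomials_def in_poly_ring_iff)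
  interpret I: ideal "Idl\<^bsub>?R\<^esub> G" ?R by (rule R.genideal_ideal[OF Gc])
  have mult: "f * g \<in> ?P" if "f \<in> carrier ?R" "g \<in> ?P" for f g
  proof -
    have "?D t" if t: "t \<in> Poly_Mapping.keys (f * g)" for t
    proof -
      obtain a b where ab: "t = a + b" "b \<in> Poly_Mapping.keys g"
        using t keys_mult[of f g] by blast
      then obtain c where c: "Poly_Mapping.single c 1 \<in> G" "monomial_dvd c b"
        using \<open>g \<in> ?P\<close> by blast
      then have "monomial_dvd c t"
        by (auto simp: monomial_dvd_def ab(1) lookup_add intro: trans_le_add2)
      with c show ?thesis by blast
    qed
    with that show ?thesis by (simp add: poly_ring_closed)
  qed
  have add: "f + g \<in> ?P" if "f \<in> ?P" "g \<in> ?P" for f g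
    using that Poly_Mapping.keys_add[of f g] poly_ring_closed(1)[of f "{1..n}" g] by blast
  have "ideal ?P ?R"
  proof (rule idealI)
    show "subgroup ?P (add_monoid ?R)"
    proof (rule R.add.subgroupI)
      fix f assume "f \<in> ?P"
      then show "\<ominus>\<^bsub>?R\<^esub> f \<in> ?P" by (auto simp: poly_ring_a_inv keys_uminus poly_ring_closed)
    next
      have "0 \<in> ?P" by (simp add: in_poly_ring_iff)
      then show "?P \<noteq> {}" by blast
      fix f g assume "f \<in> ?P" "g \<in> ?P"
      then show "f \<oplus>\<^bsub>?R\<^esub> g \<in> ?P" using add[of f g] by simp
    qed blast
    fix f g assume "f \<in> ?P" "g \<in> carrier ?R"
    then show "g \<otimes>\<^bsub>?R\<^esub> f \<in> ?P" "f \<otimes>\<^bsub>?R\<^esub> g \<in> ?P"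
      using mult[of g f] by (simp_all add: mult.commute)
  qed (rule R.ring_axioms)
  moreover have "G \<subseteq> ?P"
  proof
    fix g assume g: "g \<in> G"
    then obtain t where "g = Poly_Mapping.single t 1" using G by (auto simp: monomials_def)
    moreover have "monomial_dvd t t" by (simp add: monomial_dvd_def)
    ultimately show "g \<in> ?P" using g Gc by auto
  qed
  ultimately have sub: "Idl\<^bsub>?R\<^esub> G \<subseteq> ?P" by (rule R.genideal_minimal)
  show ?thesis
  proof
    assume "Poly_Mapping.single w 1 \<in> Idl\<^bsub>?R\<^esub> G"
    then show "Poly_Mapping.keys w \<subseteq> {1..n} \<and> ?D w"
      using sub by (force simp: in_poly_ring_iff)
  next
    assume *: "Poly_Mapping.keys w \<subseteq> {1..n} \<and> ?D w"
    then obtain t c where t: "Poly_Mapping.single t 1 \<in> G" "w = t + c"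
      by (auto simp: monomial_dvd_iff_add)
    have "Poly_Mapping.keys c \<subseteq> Poly_Mapping.keys w"
      by (auto simp: t(2) in_keys_iff lookup_add)
    with * have "Poly_Mapping.single c 1 \<in> carrier ?R" by (auto simp: in_poly_ring_iff)
    then have "Poly_Mapping.single t 1 * Poly_Mapping.single c 1 \<in> Idl\<^bsub>?R\<^esub> G"
      using I.I_r_closed[of "Poly_Mapping.single t 1"] R.genideal_self[OF Gc] t(1) by auto
    then show "Poly_Mapping.single w 1 \<in> Idl\<^bsub>?R\<^esub> G" by (simp add: mult_single t(2))
  qed
qed

text \<open>Multiplication by the monomial shifts exponents by \<open>a\<close>; conversely, a
  polynomial supported on the block can be divided by it term by term.\<close>

lemma poly_ring_mult_monomial_image:
  assumes "Poly_Mapping.keys a \<subseteq> {1..n}" "Z \<subseteq> {1..n}"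
  shows "(\<lambda>u. u * Poly_Mapping.single a 1) ` carrier (poly_ring Z :: 'k::field mpoly ring) =
    {g \<in> carrier (poly_ring {1..n}). Poly_Mapping.keys g \<subseteq> stanley_block a Z}"
proof (intro equalityI subsetI)
  fix g :: "'k mpoly"
  assume "g \<in> (\<lambda>u. u * Poly_Mapping.single a 1) ` carrier (poly_ring Z)"
  then obtain u where u: "u \<in> carrier (poly_ring Z)" "g = u * Poly_Mapping.single a 1" by blast
  have "Poly_Mapping.keys g \<subseteq> stanley_block a Z"
    using keys_mult[of u "Poly_Mapping.single a 1"] u
    by (fastforce simp: in_poly_ring_iff stanley_block_def add.commute)
  moreover have "u \<in> carrier (poly_ring {1..n})" "Poly_Mapping.single a 1 \<in> carrier (poly_ring {1..n} :: 'k mpoly ring)"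
    using u(1) assms by (auto simp: in_poly_ring_iff)
  ultimately show "g \<in> {g \<in> carrier (poly_ring {1..n}). Poly_Mapping.keys g \<subseteq> stanley_block a Z}"
    by (simp add: u(2) poly_ring_closed)
next
  fix g :: "'k mpoly"
  assume g: "g \<in> {g \<in> carrier (poly_ring {1..n}). Poly_Mapping.keys g \<subseteq> stanley_block a Z}"
  \<comment> \<open>The termwise quotient of \<open>g\<close>; \<open>t - a\<close> is an exact
    subtraction because every \<open>t\<close> lies in the block.\<close>
  define u where "u = (\<Sum>t\<in>Poly_Mapping.keys g. Poly_Mapping.single (t - a) (Poly_Mapping.lookup g t))"
  have t: "a + (t - a) = t" "Poly_Mapping.keys (t - a) \<subseteq> Z" if "t \<in> Poly_Mapping.keys g" for t
  proof -
    have "t \<in> stanley_block a Z" using g that by blast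
    then obtain c where "t = a + c" "Poly_Mapping.keys c \<subseteq> Z"
      by (auto simp: stanley_block_def)
    then show "a + (t - a) = t" "Poly_Mapping.keys (t - a) \<subseteq> Z" by simp_all
  qed
  have "u \<in> carrier (poly_ring Z)"
    unfolding in_poly_ring_iff
  proof
    fix s assume "s \<in> Poly_Mapping.keys u"
    then obtain t where "t \<in> Poly_Mapping.keys g" "s = t - a"
      unfolding u_def using keys_sum[of "\<lambda>t. Poly_Mapping.single (t - a) (Poly_Mapping.lookup g t)" "Poly_Mapping.keys g"]
      by (auto split: if_splits)
    then show "Poly_Mapping.keys s \<subseteq> Z" using t by simp
  qed
  moreover have "u * Poly_Mapping.single a 1 = g"
  proof -
    have "u * Poly_Mapping.single a 1 = (\<Sum>t\<in>Poly_Mapping.keys g. Poly_Mapping.single t (Poly_Mapping.lookup g t))"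
      unfolding u_def sum_distrib_right using t(1) by (intro sum.cong) (auto simp: mult_single add.commute)
    then show ?thesis by (simp add: sum_keys_single)
  qed
  ultimately show "g \<in> (\<lambda>u. u * Poly_Mapping.single a 1) ` carrier (poly_ring Z)" by blast
qed

text \<open>The cosets of the monomials in \<open>J\<close> but not in \<open>I\<close> form a
  K-basis of \<open>J/I\<close>. The blocks partition this basis, and the coset of the monomial of
  \<open>a i\<close> generates over \<open>K[Z i]\<close> the span of the \<open>i\<close>-th
  part.\<close>

lemma stanley_decomposition_of_blocks:
  fixes I J :: "'k::field mpoly set"
  assumes I: "monomial_ideal n I" and J: "monomial_ideal n J" and IJ: "I \<subseteq> J"
    and aZ: "\<And>i. i \<in> {1..s} \<Longrightarrow> Poly_Mapping.keys (a i) \<subseteq> {1..n} \<and> Z i \<subseteq> {1..n}"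
    and disj: "disjoint_family_on (\<lambda>i. stanley_block (a i) (Z i)) {1..s}"
    and cover: "(\<Union>i\<in>{1..s}. stanley_block (a i) (Z i)) =
      {w. Poly_Mapping.single w 1 \<in> J \<and> Poly_Mapping.single w 1 \<notin> I}"
  shows "stanley_decomposition n (quotient_module (poly_ring {1..n}) J I) (quotient_grading n J I)
    s (\<lambda>i. I +>\<^bsub>poly_ring {1..n}\<^esub> Poly_Mapping.single (a i) 1) Z"
proof -
  note One_nat_def [simp del]
  let ?R = "poly_ring {1..n} :: 'k mpoly ring"
  let ?M = "quotient_module ?R J I"
  let ?c = "\<lambda>g. I +>\<^bsub>?R\<^esub> g"
  let ?m = "\<lambda>i. Poly_Mapping.single (a i) (1::'k)"
  define B where "B i = stanley_block (a i) (Z i)" for i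
  \<comment> \<open>\<open>V i\<close> represents the \<open>i\<close>-th summand inside
    \<open>S\<close>: the quotient map sends it onto the summand (\<open>span\<close>), injectively
    because it meets \<open>I\<close> only in 0 (\<open>VI\<close>).\<close>
  define V where "V i = {g \<in> carrier ?R. Poly_Mapping.keys g \<subseteq> B i}" for i
  interpret R: cring ?R by (rule poly_ring_cring)
  interpret I: ideal I ?R by (rule monomial_ideal_ideal) fact
  interpret J: ideal J ?R by (rule monomial_ideal_ideal) fact
  interpret M: Module.module ?R ?M
    by (rule quotient_module_module) (fact R.is_cring I.ideal_axioms J.ideal_axioms IJ)+
  have M_simps [simp]: "\<zero>\<^bsub>?M\<^esub> = I" "carrier ?M = ?c ` J" "add ?M = set_add ?R"
    by (simp_all add: quotient_module_def)
  have smult: "f \<odot>\<^bsub>?M\<^esub> ?c g = ?c (f * g)" if "f \<in> carrier ?R" "g \<in> J" for f g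
    using that J.a_subset by (auto simp: quotient_module_def I.rcoset_mult_add subset_iff)
  have Jc: "g \<in> carrier ?R" if "g \<in> J" for g using that J.a_subset by blast
  have c_add: "?c f <+>\<^bsub>?R\<^esub> ?c g = ?c (f + g)" if "f \<in> J" "g \<in> J" for f g
    using that Jc by (simp add: I.a_rcos_sum)
  have c_zero: "?c 0 = I" using R.a_coset_add_zero[OF I.a_subset] by simp
  have c_eq: "?c f = ?c g \<longleftrightarrow> f - g \<in> I" if "f \<in> J" "g \<in> J" for f g
    using R.quotient_eq_iff_same_a_r_cos[OF I.ideal_axioms, of f g] Jc[OF that(1)] Jc[OF that(2)]
    by (simp add: a_minus_def poly_ring_a_inv)
  have J0: "0 \<in> J" using J.zero_closed by simp
  have Jadd: "f + g \<in> J" if "f \<in> J" "g \<in> J" for f g using J.a_closed[OF that] by simp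
  have Jneg: "- f \<in> J" if "f \<in> J" for f
    using J.a_inv_closed[OF that] Jc[OF that] by (simp add: poly_ring_a_inv)
  have V0: "0 \<in> V i" for i by (simp add: V_def in_poly_ring_iff)
  have Vadd: "f + g \<in> V i" if "f \<in> V i" "g \<in> V i" for f g i
    using that Poly_Mapping.keys_add[of f g] by (auto simp: V_def poly_ring_closed)
  have Vneg: "- f \<in> V i" if "f \<in> V i" for f i
    using that by (auto simp: V_def poly_ring_closed keys_uminus)
  have mem_B: "(\<exists>i\<in>{1..s}. w \<in> B i) \<longleftrightarrow> Poly_Mapping.single w 1 \<in> J \<and> Poly_Mapping.single w 1 \<notin> I" for w
    using cover unfolding B_def set_eq_iff UN_iff mem_Collect_eq by blast
  have disjB: "w \<notin> B j" if "w \<in> B i" "i \<in> {1..s}" "j \<in> {1..s}" "i \<noteq> j" for w i j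
    using disj that unfolding disjoint_family_on_def B_def by blast
  have VJ: "f \<in> J" if "f \<in> V i" "i \<in> {1..s}" for f i
    unfolding monomial_ideal_mem_iff[OF J, of f] using that mem_B unfolding V_def by blast
  have VI: "f = 0" if "f \<in> V i" "i \<in> {1..s}" "f \<in> I" for f i
  proof -
    have "Poly_Mapping.keys f = {}"
      using that mem_B unfolding monomial_ideal_mem_iff[OF I, of f] V_def by blast
    then show ?thesis by simp
  qed
  have V_img: "(\<lambda>u. u * ?m i) ` carrier (poly_ring (Z i)) = V i" if "i \<in> {1..s}" for i
    unfolding V_def B_def by (rule poly_ring_mult_monomial_image) (use aZ[OF that] in auto)
  have mJ: "?m i \<in> J" if "i \<in> {1..s}" for i
    using mem_B[of "a i"] that stanley_block_self[of "a i" "Z i"] unfolding B_def by blast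
  have Zc: "u \<in> carrier ?R" if "u \<in> carrier (poly_ring (Z i))" "i \<in> {1..s}" for u i
    using that aZ by (fastforce simp: in_poly_ring_iff)
  have span: "cyclic_span ?M (?c (?m i)) (Z i) = ?c ` V i" if i: "i \<in> {1..s}" for i
  proof -
    have "cyclic_span ?M (?c (?m i)) (Z i) = (\<lambda>u. ?c (u * ?m i)) ` carrier (poly_ring (Z i))"
      unfolding cyclic_span_def using smult[OF Zc[OF _ i] mJ[OF i]] by (auto simp: image_def)
    then show ?thesis unfolding V_img[OF i, symmetric] by (simp add: image_image)
  qed
  have fin: "finsum ?M (\<lambda>i. ?c (F i)) A = ?c (sum F A) \<and> sum F A \<in> J"
    if "finite A" "\<And>i. i \<in> A \<Longrightarrow> F i \<in> J" for F and A :: "nat set"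
    using that
  proof (induction A)
    case empty then show ?case using c_zero J0 by simp
  next
    case (insert i A)
    then have "finsum ?M (\<lambda>i. ?c (F i)) (insert i A) = ?c (F i) \<oplus>\<^bsub>?M\<^esub> finsum ?M (\<lambda>i. ?c (F i)) A"
      by (intro M.finsum_insert) auto
    with insert show ?case by (simp add: c_add Jadd)
  qed
  \<comment> \<open>\<open>internal_direct_sum\<close> sums over the nonzero components only;
    including the zero ones makes the index set independent of \<open>y\<close>.\<close>
  have support_sum: "finsum ?M y {i\<in>{1..s}. y i \<noteq> I} = ?c (sum F {1..s}) \<and> sum F {1..s} \<in> J"
    if "\<And>i. i \<in> {1..s} \<Longrightarrow> F i \<in> J \<and> y i = ?c (F i)" for y F
  proof -
    have "finsum ?M y {i\<in>{1..s}. y i \<noteq> I} = finsum ?M (\<lambda>i. ?c (F i)) {1..s}"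
      using that by (intro M.add.finprod_mono_neutral_cong_left) auto
    then show ?thesis using fin[of "{1..s}" F] that by simp
  qed
  have sub: "additive_subgroup (?c ` V i) ?M" if i: "i \<in> {1..s}" for i
  proof (rule additive_subgroup.intro, rule M.add.subgroupI)
    show "?c ` V i \<subseteq> carrier ?M" using VJ[OF _ i] by auto
    show "?c ` V i \<noteq> {}" using V0 by blast
    fix x assume "x \<in> ?c ` V i"
    then obtain f where f: "f \<in> V i" "x = ?c f" by blast
    have "\<ominus>\<^bsub>?M\<^esub> x = ?c (- f)"
      using f VJ[OF f(1) i] Jneg c_add[of "- f" f] c_zero by (intro M.minus_equality) auto
    then show "\<ominus>\<^bsub>?M\<^esub> x \<in> ?c ` V i" using Vneg[OF f(1)] by blast
  next
    fix x y assume "x \<in> ?c ` V i" "y \<in> ?c ` V i"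
    then obtain f g where fg: "f \<in> V i" "x = ?c f" "g \<in> V i" "y = ?c g" by blast
    then have "x \<oplus>\<^bsub>?M\<^esub> y = ?c (f + g)" using VJ[OF _ i] by (simp add: c_add)
    then show "x \<oplus>\<^bsub>?M\<^esub> y \<in> ?c ` V i" using Vadd[OF fg(1,3)] by blast
  qed
  have ex: "\<exists>y. y \<in> (\<Pi>\<^sub>E i\<in>{1..s}. ?c ` V i) \<and> finite {i\<in>{1..s}. y i \<noteq> I} \<and>
      x = finsum ?M y {i\<in>{1..s}. y i \<noteq> I}" if x: "x \<in> carrier ?M" for x
  proof -
    obtain f where f: "f \<in> J" "x = ?c f" using x by auto
    \<comment> \<open>The terms of \<open>f\<close> in the \<open>i\<close>-th block. What is left
      of \<open>f\<close> after removing all \<open>F i\<close> has monomials in \<open>J\<close>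
      but in no block, hence in \<open>I\<close>.\<close>
    define F where "F i = (\<Sum>t\<in>Poly_Mapping.keys f \<inter> B i.
      Poly_Mapping.single t (Poly_Mapping.lookup f t))" for i
    have lookup_F: "Poly_Mapping.lookup (F i) t = (if t \<in> B i then Poly_Mapping.lookup f t else 0)" for i t
      unfolding F_def by (simp add: lookup_sum lookup_single when_def sum.delta in_keys_iff)
    have FV: "F i \<in> V i" for i
      using Jc[OF f(1)] by (auto simp: V_def in_poly_ring_iff in_keys_iff lookup_F split: if_splits)
    have "Poly_Mapping.single t 1 \<in> I" if t: "t \<in> Poly_Mapping.keys (f - sum F {1..s})" for t
    proof -
      have "t \<notin> B i" if i: "i \<in> {1..s}" for i
      proof
        assume tB: "t \<in> B i"
        have "Poly_Mapping.lookup (F j) t = (if j = i then Poly_Mapping.lookup f t else 0)" if "j \<in> {1..s}" for j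
          using disjB[OF tB i that] tB by (auto simp: lookup_F)
        then have "Poly_Mapping.lookup (sum F {1..s}) t = Poly_Mapping.lookup f t"
          using i by (simp add: lookup_sum sum.delta)
        with t show False by (simp add: in_keys_iff lookup_minus)
      qed
      moreover from this have "t \<in> Poly_Mapping.keys f"
        using t by (simp add: in_keys_iff lookup_minus lookup_sum lookup_F)
      ultimately show ?thesis
        using mem_B[of t] f(1) unfolding monomial_ideal_mem_iff[OF J, of f] by blast
    qed
    moreover have FJ: "F i \<in> J" if "i \<in> {1..s}" for i using VJ[OF FV that] .
    define y where "y = restrict (\<lambda>i. ?c (F i)) {1..s}"
    have y: "finsum ?M y {i\<in>{1..s}. y i \<noteq> I} = ?c (sum F {1..s})" "sum F {1..s} \<in> J"
      using support_sum[of F y] FJ by (auto simp: y_def)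
    have "f - sum F {1..s} \<in> J" using Jadd[OF f(1) Jneg[OF y(2)]] by simp
    ultimately have "f - sum F {1..s} \<in> I"
      unfolding monomial_ideal_mem_iff[OF I, of "f - sum F {1..s}"] using Jc by blast
    then have "x = finsum ?M y {i\<in>{1..s}. y i \<noteq> I}" using y f c_eq by simp
    moreover have "y \<in> (\<Pi>\<^sub>E i\<in>{1..s}. ?c ` V i)" using FV by (auto simp: y_def)
    ultimately show ?thesis by auto
  qed
  have uniq: "y = z" if y: "y \<in> (\<Pi>\<^sub>E i\<in>{1..s}. ?c ` V i)" and z: "z \<in> (\<Pi>\<^sub>E i\<in>{1..s}. ?c ` V i)"
    and eq: "finsum ?M y {i\<in>{1..s}. y i \<noteq> I} = finsum ?M z {i\<in>{1..s}. z i \<noteq> I}" for y z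
  proof (rule PiE_ext[OF y z])
    have "\<forall>i\<in>{1..s}. \<exists>f. f \<in> V i \<and> y i = ?c f" using PiE_mem[OF y] by blast
    from bchoice[OF this] obtain F where F: "\<And>i. i \<in> {1..s} \<Longrightarrow> F i \<in> V i \<and> y i = ?c (F i)" by blast
    have "\<forall>i\<in>{1..s}. \<exists>f. f \<in> V i \<and> z i = ?c f" using PiE_mem[OF z] by blast
    from bchoice[OF this] obtain G where G: "\<And>i. i \<in> {1..s} \<Longrightarrow> G i \<in> V i \<and> z i = ?c (G i)" by blast
    have FGJ: "F i \<in> J" "G i \<in> J" if "i \<in> {1..s}" for i using F G VJ that by blast+
    have "?c (sum F {1..s}) = ?c (sum G {1..s})" "sum F {1..s} \<in> J" "sum G {1..s} \<in> J"
      using support_sum[of F y] support_sum[of G z] F G FGJ eq by simp_all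
    then have D: "(\<Sum>i\<in>{1..s}. F i - G i) \<in> I" by (simp add: c_eq sum_subtractf)
    fix i assume i: "i \<in> {1..s}"
    have FG: "F j - G j \<in> V j" if "j \<in> {1..s}" for j
      using Vadd[of "F j" j "- G j"] Vneg[of "G j" j] F G that by simp
    have "F i - G i \<in> I"
      unfolding monomial_ideal_mem_iff[OF I, of "F i - G i"]
    proof (intro conjI ballI)
      show "F i - G i \<in> carrier ?R" using FG[OF i] by (simp add: V_def)
      fix t assume t: "t \<in> Poly_Mapping.keys (F i - G i)"
      then have tB: "t \<in> B i" using FG[OF i] by (auto simp: V_def)
      \<comment> \<open>By disjointness only the \<open>i\<close>-th difference has a coefficient at
        \<open>t\<close>, so \<open>t\<close> also occurs in the sum, which lies in
        \<open>I\<close>. As \<open>I\<close> is a monomial ideal, it contains the monomial of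
        \<open>t\<close>.\<close>
      have "Poly_Mapping.lookup (F j - G j) t = 0" if "j \<in> {1..s}" "j \<noteq> i" for j
      proof -
        have "Poly_Mapping.keys (F j - G j) \<subseteq> B j" using FG[OF that(1)] by (simp add: V_def)
        moreover have "t \<notin> B j" using disjB[OF tB i that(1)] that(2) by simp
        ultimately show ?thesis by (meson in_keys_iff subsetD)
      qed
      then have "Poly_Mapping.lookup (\<Sum>j\<in>{1..s}. F j - G j) t = Poly_Mapping.lookup (F i - G i) t"
        unfolding lookup_sum using i by (subst sum.remove[of _ i]) (auto intro!: sum.neutral)
      then have "t \<in> Poly_Mapping.keys (\<Sum>j\<in>{1..s}. F j - G j)" using t by (simp add: in_keys_iff)
      then show "Poly_Mapping.single t 1 \<in> I"
        using D unfolding monomial_ideal_mem_iff[OF I, of "\<Sum>j\<in>{1..s}. F j - G j"] by blast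
    qed
    then show "y i = z i" using F[OF i] G[OF i] FGJ[OF i] c_eq by simp
  qed
  have "\<exists>b\<in>Zn n. ?c (?m i) \<in> quotient_grading n J I b" if i: "i \<in> {1..s}" for i
  proof
    let ?b = "\<lambda>x. int (Poly_Mapping.lookup (a i) x)"
    show "?b \<in> Zn n" using aZ[OF i] by (auto simp: Zn_def subset_iff in_keys_iff)
    have "?m i \<in> homogeneous_part n ?b" using Jc[OF mJ[OF i]] by (simp add: homogeneous_part_def)
    then show "?c (?m i) \<in> quotient_grading n J I ?b" using mJ[OF i] by (auto simp: quotient_grading_def)
  qed
  moreover have "u = 0" if i: "i \<in> {1..s}" and u: "u \<in> carrier (poly_ring (Z i))"
    and 0: "u \<odot>\<^bsub>?M\<^esub> ?c (?m i) = I" for i u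
  proof -
    have uV: "u * ?m i \<in> V i" using V_img[OF i] u by blast
    have "?c (u * ?m i) = ?c 0" using smult[OF Zc[OF u i] mJ[OF i]] 0 c_zero by simp
    then have "u * ?m i \<in> I" using c_eq[OF VJ[OF uV i] J0] by simp
    then have "u * ?m i = 0" by (rule VI[OF uV i])
    \<comment> \<open>The polynomial ring has no zero divisors, so the monomial factor cancels,
      which gives freeness.\<close>
    moreover have "?m i \<noteq> 0" by (metis lookup_single_eq lookup_zero one_neq_zero)
    ultimately show ?thesis by simp
  qed
  moreover have "internal_direct_sum ?M {1..s} (\<lambda>i. cyclic_span ?M (?c (?m i)) (Z i))"
  proof -
    have P: "(\<Pi>\<^sub>E i\<in>{1..s}. cyclic_span ?M (?c (?m i)) (Z i)) = (\<Pi>\<^sub>E i\<in>{1..s}. ?c ` V i)"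
      by (rule PiE_cong) (rule span)
    show ?thesis
      unfolding internal_direct_sum_def P M_simps(1)
    proof (intro conjI ballI)
      fix i assume "i \<in> {1..s}"
      then show "additive_subgroup (cyclic_span ?M (?c (?m i)) (Z i)) ?M" by (simp only: span sub)
    next
      fix x assume x: "x \<in> carrier ?M"
      show "\<exists>!y. y \<in> (\<Pi>\<^sub>E i\<in>{1..s}. ?c ` V i) \<and> finite {i\<in>{1..s}. y i \<noteq> I} \<and>
        x = finsum ?M y {i\<in>{1..s}. y i \<noteq> I}"
      proof (rule ex_ex1I)
        fix y z
        assume "y \<in> (\<Pi>\<^sub>E i\<in>{1..s}. ?c ` V i) \<and> finite {i\<in>{1..s}. y i \<noteq> I} \<and>
            x = finsum ?M y {i\<in>{1..s}. y i \<noteq> I}"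
          and "z \<in> (\<Pi>\<^sub>E i\<in>{1..s}. ?c ` V i) \<and> finite {i\<in>{1..s}. z i \<noteq> I} \<and>
            x = finsum ?M z {i\<in>{1..s}. z i \<noteq> I}"
        then show "y = z" by (elim conjE) (rule uniq, assumption+, simp only:)
      qed (rule ex[OF x])
    qed
  qed
  ultimately show ?thesis
    unfolding stanley_decomposition_def M_simps using mJ aZ by blast
qed

section \<open>The lower bound for the Stanley depth\<close>

lemma sdepth_ge:
  assumes "stanley_decomposition n M gr s m Z" "s \<ge> 1" "\<And>i. i \<in> {1..s} \<Longrightarrow> d \<le> card (Z i)"
  shows "d \<le> sdepth n M gr"
proof -
  let ?S = "{Min ((\<lambda>i. card (Z i)) ` {1..s}) | s m Z. stanley_decomposition n M gr s m Z}"
  \<comment> \<open>\<open>Max_ge\<close> needs a finite set. A decomposition with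
    \<open>s = 0\<close> would contribute the unspecified number \<open>Min {}\<close>, so the
    finite superset includes it.\<close>
  have "Min ((\<lambda>i. card (Z i)) ` {1..s}) \<in> {0..n} \<union> {Min {}}"
    if "stanley_decomposition n M gr s m Z" for s m Z
  proof (cases "s = 0")
    case False
    then have 1: "1 \<in> {1..s}" by simp
    then have "Z 1 \<subseteq> {1..n}" using that unfolding stanley_decomposition_def by blast
    then have "card (Z 1) \<le> n" using card_mono[of "{1..n}" "Z 1"] by simp
    moreover have "Min ((\<lambda>i. card (Z i)) ` {1..s}) \<le> card (Z 1)" using 1 by (intro Min_le) auto
    ultimately show ?thesis by simp
  qed simp
  then have "?S \<subseteq> {0..n} \<union> {Min {}}" by blast
  then have "finite ?S" by (rule finite_subset) simp
  moreover have "Min ((\<lambda>i. card (Z i)) ` {1..s}) \<in> ?S" using assms(1) by blast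
  ultimately have "Min ((\<lambda>i. card (Z i)) ` {1..s}) \<le> sdepth n M gr"
    unfolding sdepth_def by (rule Max_ge)
  moreover have "d \<le> Min ((\<lambda>i. card (Z i)) ` {1..s})" using assms(2,3) by simp
  ultimately show ?thesis by linarith
qed

theorem proposition2p9:
  fixes I J :: "'k::field mpoly set"
    and u v :: "nat \<Rightarrow> 'k mpoly"
    and n p q r :: nat
  assumes "monomial_ideal n I" and "monomial_ideal n J" and "I \<subset> J"
    and "minimal_monomial_generators n I (v ` {1..p})" and "inj_on v {1..p}"
    and "minimal_monomial_generators n J (u ` {1..q})" and "inj_on u {1..q}"
    and "r \<le> p" and "r \<le> q"
    and "\<forall>i\<in>{1..r}. u i = v i"
    and "\<forall>i\<in>{r+1..q}. u i \<notin> I"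
  shows "int (sdepth n (quotient_module (poly_ring {1..n}) J I) (quotient_grading n J I))
    \<ge> int n - int p - \<lfloor>(real q - real r) / 2\<rfloor>"
proof -
  note One_nat_def [simp del]
  let ?R = "poly_ring {1..n} :: 'k mpoly ring"
  let ?x = "\<lambda>w :: nat \<Rightarrow>\<^sub>0 nat. Poly_Mapping.single w (1::'k)"
  have v: "v ` {1..p} \<subseteq> monomials {1..n}" "Idl\<^bsub>?R\<^esub> (v ` {1..p}) = I"
    and u: "u ` {1..q} \<subseteq> monomials {1..n}" "Idl\<^bsub>?R\<^esub> (u ` {1..q}) = J"
    using assms(4,6) by (simp_all add: minimal_monomial_generators_def)
  have "\<forall>i\<in>{1..p}. \<exists>t. v i = ?x t" "\<forall>i\<in>{1..q}. \<exists>t. u i = ?x t"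
    using v(1) u(1) unfolding monomials_def by blast+
  then obtain b c where b: "\<And>i. i \<in> {1..p} \<Longrightarrow> v i = ?x (b i)" and c: "\<And>i. i \<in> {1..q} \<Longrightarrow> u i = ?x (c i)"
    by metis
  have inj: "?x t = ?x t' \<longleftrightarrow> t = t'" for t t'
    by (metis keys_single one_neq_zero singleton_inject)
  have I_iff: "?x w \<in> I \<longleftrightarrow> Poly_Mapping.keys w \<subseteq> {1..n} \<and> (\<exists>i\<in>{1..p}. monomial_dvd (b i) w)" for w
  proof -
    have "?x t \<in> v ` {1..p} \<longleftrightarrow> (\<exists>i\<in>{1..p}. t = b i)" for t
      using b inj by (auto simp: image_iff)
    then show ?thesis unfolding v(2)[symmetric] monomial_mem_genideal_iff[OF v(1)] by auto
  qed
  have J_iff: "?x w \<in> J \<longleftrightarrow> Poly_Mapping.keys w \<subseteq> {1..n} \<and> (\<exists>i\<in>{1..q}. monomial_dvd (c i) w)" for w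
  proof -
    have "?x t \<in> u ` {1..q} \<longleftrightarrow> (\<exists>i\<in>{1..q}. t = c i)" for t
      using c inj by (auto simp: image_iff)
    then show ?thesis unfolding u(2)[symmetric] monomial_mem_genideal_iff[OF u(1)] by auto
  qed
  have bc: "b i = c i" if "i \<in> {1..r}" for i
    using that assms(8-10) b[of i] c[of i] inj by auto
  define X where "X = {w. ?x w \<in> J \<and> ?x w \<notin> I}"
  define d where "d = int (q - r) div 2 + int p"
  \<comment> \<open>The generators \<open>u i\<close> with \<open>i \<le> r\<close> are among the
    \<open>v j\<close>, so their multiples are excluded anyway. The others are renumbered from 0 to
    fit the range \<open>i < N\<close>.\<close>
  have X: "X = {w \<in> {w. Poly_Mapping.keys w \<subseteq> {1..n} \<and> (\<exists>i<q - r. monomial_dvd (c (r + 1 + i)) w)}.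
      \<forall>j\<in>{1..p}. \<not> monomial_dvd (b j) w}"
  proof -
    have "(\<exists>i\<in>{1..q}. monomial_dvd (c i) w) \<longleftrightarrow> (\<exists>i<q - r. monomial_dvd (c (r + 1 + i)) w)"
      if w: "\<forall>j\<in>{1..p}. \<not> monomial_dvd (b j) w" for w
    proof
      assume "\<exists>i\<in>{1..q}. monomial_dvd (c i) w"
      then obtain i where i: "i \<in> {1..q}" "monomial_dvd (c i) w" by blast
      have "i \<notin> {1..r}"
      proof
        assume ir: "i \<in> {1..r}"
        then have "i \<in> {1..p}" using assms(8) by simp
        then show False using w i(2) unfolding bc[OF ir, symmetric] by blast
      qed
      then have "i - (r + 1) < q - r" "r + 1 + (i - (r + 1)) = i" using i by auto
      then show "\<exists>i<q - r. monomial_dvd (c (r + 1 + i)) w" using i(2) by metis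
    next
      assume "\<exists>i<q - r. monomial_dvd (c (r + 1 + i)) w"
      then obtain i where i: "i < q - r" "monomial_dvd (c (r + 1 + i)) w" by blast
      then have "r + 1 + i \<in> {1..q}" by auto
      with i(2) show "\<exists>i\<in>{1..q}. monomial_dvd (c i) w" by blast
    qed
    then show ?thesis unfolding X_def I_iff J_iff by blast
  qed
  \<comment> \<open>The multiples of the \<open>q - r\<close> remaining generators cost
    \<open>(q - r) div 2\<close>, and each of the \<open>p\<close> monomials to be avoided costs one
    more.\<close>
  have "stanley_partition n d X"
    unfolding X d_def by (intro stanley_partition_avoid stanley_partition_some_multiple)
  then obtain s a Z where
    aZ: "\<forall>i\<in>{1..s}. Poly_Mapping.keys (a i) \<subseteq> {1..n} \<and> Z i \<subseteq> {1..n} \<and> int n \<le> int (card (Z i)) + d"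
    and disj: "disjoint_family_on (\<lambda>i. stanley_block (a i) (Z i)) {1..s}"
    and cover: "(\<Union>i\<in>{1..s::nat}. stanley_block (a i) (Z i)) = X"
    using stanley_partition_imp_blocks by blast
  have D: "stanley_decomposition n (quotient_module ?R J I) (quotient_grading n J I)
      s (\<lambda>i. I +>\<^bsub>?R\<^esub> ?x (a i)) Z"
    using assms(1-3) aZ disj cover unfolding X_def by (intro stanley_decomposition_of_blocks) auto
  \<comment> \<open>A monomial ideal is determined by its monomials, so \<open>X\<close> is
    nonempty. This gives \<open>s \<ge> 1\<close>, and the minimum is taken over a nonempty
    set.\<close>
  have "X \<noteq> {}"
  proof
    assume "X = {}"
    then have "f \<in> I" if "f \<in> J" for f
      using that monomial_ideal_mem_iff[OF assms(1), of f] monomial_ideal_mem_iff[OF assms(2), of f]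
      by (auto simp: X_def)
    with assms(3) show False by blast
  qed
  then have "s \<ge> 1" using cover by (cases s) (auto simp: One_nat_def)
  \<comment> \<open>If \<open>int n - d\<close> is negative, \<open>nat\<close> turns it into the
    trivial bound 0.\<close>
  then have "nat (int n - d) \<le> sdepth n (quotient_module ?R J I) (quotient_grading n J I)"
    using aZ by (intro sdepth_ge[OF D]) (auto simp: nat_le_iff algebra_simps)
  moreover have "\<lfloor>(real q - real r) / 2\<rfloor> = int (q - r) div 2"
    using assms(9) floor_divide_of_int_eq[of "int (q - r)" 2, where 'a = real] by (simp add: of_nat_diff)
  ultimately show ?thesis by (simp add: d_def)
qed

end
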